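(* Let $D$ be an integrally closed domain with quotient field $K$, and let $A\supseteq D$ be a torsion-free $D$-algebra (not necessarily commutative) that is finitely generated as a $D$-module. Let $B=A\otimes_D K$ and $n=\dim_K B$. Assume that $D$ has finite residue rings. Then $\mathrm{Int}_K(A,A')=\mathrm{Int}_K(\Omega_A,\Lambda_n)$, and this ring is the integral closure (in its quotient field) of both $\bigcap_{a\in A}\bigl(D[X]+\mu_a(X)\cdot K[X]\bigr)$ and $\mathrm{Int}_K(A)$.
   Context: Algebras are associative and unital. $D$, $A$ and $K$ are regarded as subrings of $B=A\otimes_D K$; $K$ is central in $B$, so polynomials in $K[X]$ can be evaluated at elements of $B$. $D$ has finite residue rings if $D/I$ is finite for every proper nonzero ideal $I\subset D$. $\overline{K}$ is a fixed algebraic closure of $K$. For $b\in B$, $\mu_b(X)\in K[X]$ is the minimal polynomial of $b$ over $K$, i.e. the monic generator of $\{f\in K[X]\mid f(b)=0\}$, and $\Omega_b$ is the set of roots of $\mu_b$ in $\overline{K}$; $\Omega_A=\bigcup_{a\in A}\Omega_a$. An element $b\in B$ is integral (over $D$) if it is a root of a monic polynomial in $D[X]$. $A'=\{b\in B\mid b\text{ is integral over }D\}$. $\mathrm{Int}_K(A)=\{f\in K[X]\mid f(A)\subseteq A\}$ and $\mathrm{Int}_K(A,A')=\{f\in K[X]\mid f(A)\subseteq A'\}$. $\Lambda_n=\{\alpha\in\overline{K}\mid \alpha\text{ is a root of a monic polynomial in }D[X]\text{ of degree }n\}$, and $\mathrm{Int}_K(\mathcal{E},\Lambda_n)=\{f\in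 K[X]\mid f(\mathcal{E})\subseteq\Lambda_n\}$ for $\mathcal{E}\subseteq\Lambda_n$. *)

theory Defs
  imports
    "HOL-Library.Poly_Mapping"
    "HOL-Computational_Algebra.Computational_Algebra"
    "HOL-Algebra.Algebraic_Closure_Type"
begin

text \<open>
  Throughout, \<open>'d\<close> is the domain \<open>D\<close>, \<open>'d fract\<close> its quotient field \<open>K\<close>, \<open>'d fract alg_closure\<close>
  an algebraic closure of \<open>K\<close>, \<open>'a\<close> the \<open>D\<close>-algebra \<open>A\<close> and \<open>'b\<close> the ring \<open>B\<close>. The embeddings of
  \<open>D\<close> into \<open>K\<close> and of \<open>K\<close> into its closure are \<open>to_fract\<close> and \<open>to_ac\<close>.
\<close>

definition integral_over :: "'e::comm_ring_1 set \<Rightarrow> 'e \<Rightarrow> bool" where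
  "integral_over R x \<longleftrightarrow> (\<exists>p. lead_coeff p = 1 \<and> (\<forall>i. Polynomial.coeff p i \<in> R) \<and> poly p x = 0)"

text \<open>For a subring \<open>R\<close> of a domain, realised inside the quotient field of that domain.\<close>

definition quotient_field_of :: "'e::idom set \<Rightarrow> 'e fract set" where
  "quotient_field_of R = {Fract x y | x y. x \<in> R \<and> y \<in> R \<and> y \<noteq> 0}"

definition integral_closure :: "'e::idom set \<Rightarrow> 'e fract set" where
  "integral_closure R = {z \<in> quotient_field_of R. integral_over (to_fract ` R) z}"

definition integrally_closed :: "'d::idom itself \<Rightarrow> bool" where
  "integrally_closed _ \<longleftrightarrow> integral_closure (UNIV :: 'd set) = range to_fract"

definition finite_residue_rings :: "'d::idom itself \<Rightarrow> bool" where
  "finite_residue_rings _ \<longleftrightarrow>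
     (\<forall>I. ideal I (ring_of_type_algebra :: 'd ring) \<and> I \<noteq> {0} \<and> I \<noteq> UNIV \<longrightarrow>
        finite (carrier ((ring_of_type_algebra :: 'd ring) Quot I)))"

locale unital_algebra = Modules.module scale
  for scale :: "'r::comm_ring_1 \<Rightarrow> 'a::ring_1 \<Rightarrow> 'a" +
  assumes scale_mult_left: "scale r x * y = scale r (x * y)"
    and scale_mult_right: "x * scale r y = scale r (x * y)"

definition torsion_free :: "('r::zero \<Rightarrow> 'm::zero \<Rightarrow> 'm) \<Rightarrow> bool" where
  "torsion_free scale \<longleftrightarrow> (\<forall>r x. scale r x = 0 \<longrightarrow> r = 0 \<or> x = 0)"

definition finitely_generated :: "('r::comm_ring_1 \<Rightarrow> 'm::ab_group_add \<Rightarrow> 'm) \<Rightarrow> bool" where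
  "finitely_generated scale \<longleftrightarrow> (\<exists>S. finite S \<and> Modules.module.span scale S = UNIV)"

text \<open>
  The tensor product of two \<open>D\<close>-modules is the free abelian group on pairs modulo the subgroup
  \<open>tensor_relations\<close>. A map \<open>t\<close> of pairs into \<open>'b\<close> presents \<open>'b\<close> as this tensor product, with
  \<open>t x y\<close> in the role of the pure tensor of \<open>x\<close> and \<open>y\<close>, if its extension to the free abelian
  group induces a bijection from the quotient onto \<open>'b\<close>.
\<close>

inductive_set tensor_relations ::
    "('d \<Rightarrow> 'm \<Rightarrow> 'm) \<Rightarrow> ('d \<Rightarrow> 'n \<Rightarrow> 'n) \<Rightarrow> ('m::plus \<times> 'n::plus \<Rightarrow>\<^sub>0 int) set"
  for scale1 :: "'d \<Rightarrow> 'm \<Rightarrow> 'm" and scale2 :: "'d \<Rightarrow> 'n \<Rightarrow> 'n" where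
  add_left: "frag_of (x + x', y) - frag_of (x, y) - frag_of (x', y) \<in> tensor_relations scale1 scale2"
| add_right: "frag_of (x, y + y') - frag_of (x, y) - frag_of (x, y') \<in> tensor_relations scale1 scale2"
| balanced: "frag_of (scale1 d x, y) - frag_of (x, scale2 d y) \<in> tensor_relations scale1 scale2"
| diff: "F \<in> tensor_relations scale1 scale2 \<Longrightarrow> G \<in> tensor_relations scale1 scale2 \<Longrightarrow>
    F - G \<in> tensor_relations scale1 scale2"

definition tensor_lift :: "('m \<Rightarrow> 'n \<Rightarrow> 'b::ring_1) \<Rightarrow> ('m \<times> 'n \<Rightarrow>\<^sub>0 int) \<Rightarrow> 'b" where
  "tensor_lift t F =
     (\<Sum>(x, y) \<in> Poly_Mapping.keys F. of_int (Poly_Mapping.lookup F (x, y)) * t x y)"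

definition is_tensor_product ::
    "('d \<Rightarrow> 'm::plus \<Rightarrow> 'm) \<Rightarrow> ('d \<Rightarrow> 'n::plus \<Rightarrow> 'n) \<Rightarrow> ('m \<Rightarrow> 'n \<Rightarrow> 'b::ring_1) \<Rightarrow> bool" where
  "is_tensor_product scale1 scale2 t \<longleftrightarrow>
     surj (tensor_lift t) \<and> (\<forall>F. tensor_lift t F = 0 \<longleftrightarrow> F \<in> tensor_relations scale1 scale2)"

definition is_base_change_to_fract ::
    "('d::idom \<Rightarrow> 'a::ring_1 \<Rightarrow> 'a) \<Rightarrow> ('a \<Rightarrow> 'd fract \<Rightarrow> 'b::ring_1) \<Rightarrow> bool" where
  "is_base_change_to_fract scale t \<longleftrightarrow>
     is_tensor_product scale (\<lambda>d k. to_fract d * k) t \<and>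
     t 1 1 = 1 \<and> (\<forall>x k y l. t x k * t y l = t (x * y) (k * l))"

text \<open>
  In the following, \<open>t\<close> is such a presentation of \<open>B\<close>; \<open>A\<close> and \<open>K\<close> are viewed inside \<open>B\<close> by way of
  \<open>\<lambda>a. t a 1\<close> and \<open>\<lambda>k. t 1 k\<close>.
\<close>

definition A_in_B :: "('a \<Rightarrow> 'd::idom fract \<Rightarrow> 'b) \<Rightarrow> 'b set" where
  "A_in_B t = range (\<lambda>a. t a 1)"

definition K_scale :: "('a::one \<Rightarrow> 'd::idom fract \<Rightarrow> 'b::times) \<Rightarrow> 'd fract \<Rightarrow> 'b \<Rightarrow> 'b" where
  "K_scale t k b = t 1 k * b"

definition dim_B :: "('a::one \<Rightarrow> 'd::idom fract \<Rightarrow> 'b::ring_1) \<Rightarrow> nat" where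
  "dim_B t = vector_space.dim (K_scale t) UNIV"

definition eval_B :: "('a::one \<Rightarrow> 'd::idom fract \<Rightarrow> 'b::ring_1) \<Rightarrow> 'd fract poly \<Rightarrow> 'b \<Rightarrow> 'b" where
  "eval_B t f b = (\<Sum>i\<le>Polynomial.degree f. K_scale t (Polynomial.coeff f i) (b ^ i))"

definition min_poly :: "('a::one \<Rightarrow> 'd::idom fract \<Rightarrow> 'b::ring_1) \<Rightarrow> 'b \<Rightarrow> 'd fract poly" where
  "min_poly t b = (THE p. lead_coeff p = 1 \<and> {f. eval_B t f b = 0} = {f. p dvd f})"

definition Omega :: "('a::one \<Rightarrow> 'd::idom fract \<Rightarrow> 'b::ring_1) \<Rightarrow> 'b \<Rightarrow> 'd fract alg_closure set" where
  "Omega t b = {\<alpha>. poly (map_poly to_ac (min_poly t b)) \<alpha> = 0}"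

definition Omega_A :: "('a::one \<Rightarrow> 'd::idom fract \<Rightarrow> 'b::ring_1) \<Rightarrow> 'd fract alg_closure set" where
  "Omega_A t = (\<Union>a \<in> A_in_B t. Omega t a)"

definition A' :: "('a::one \<Rightarrow> 'd::idom fract \<Rightarrow> 'b::ring_1) \<Rightarrow> 'b set" where
  "A' t = {b. \<exists>p :: 'd poly. lead_coeff p = 1 \<and> eval_B t (map_poly to_fract p) b = 0}"

definition Lambda :: "nat \<Rightarrow> 'd::idom fract alg_closure set" where
  "Lambda n = {\<alpha>. \<exists>p :: 'd poly. lead_coeff p = 1 \<and> Polynomial.degree p = n \<and>
                     poly (map_poly (\<lambda>d. to_ac (to_fract d)) p) \<alpha> = 0}"

definition Int_B :: "('a::one \<Rightarrow> 'd::idom fract \<Rightarrow> 'b::ring_1) \<Rightarrow> 'b set \<Rightarrow> 'b set \<Rightarrow> 'd fract poly set" where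
  "Int_B t S T = {f. \<forall>b\<in>S. eval_B t f b \<in> T}"

definition Int_K :: "'d::idom fract alg_closure set \<Rightarrow> 'd fract alg_closure set \<Rightarrow> 'd fract poly set" where
  "Int_K S T = {f. \<forall>\<alpha>\<in>S. poly (map_poly to_ac f) \<alpha> \<in> T}"

definition pullback_ring :: "('a::one \<Rightarrow> 'd::idom fract \<Rightarrow> 'b::ring_1) \<Rightarrow> 'b \<Rightarrow> 'd fract poly set" where
  "pullback_ring t a = {map_poly to_fract g + min_poly t a * h | g h. True}"

end

theory Submission
  imports Defs
begin

text \<open>
  All three rings are compared through one condition on \<open>f\<close>: that \<open>f(\<alpha>)\<close> is integral over \<open>D\<close> for every
  \<open>\<alpha> \<in> \<Omega>\<^sub>A\<close>. If \<open>f(a)\<close> is integral, the minimal polynomial of \<open>f(a)\<close> has coefficients in \<open>D\<close>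
  (they are integral, being polynomials in its roots, and \<open>D\<close> is integrally closed), has degree at most
  \<open>n\<close>, and annihilates \<open>f(\<alpha>)\<close> for all \<open>\<alpha> \<in> \<Omega>\<^sub>a\<close>; multiplying it by a power of \<open>X\<close> gives
  \<open>f(\<alpha>) \<in> \<Lambda>\<^sub>n\<close>. Conversely, if \<open>p \<in> D[X]\<close> is the product of monic polynomials annihilating the \<open>f(\<alpha>)\<close>,
  then \<open>p(f(X))\<close> vanishes on \<open>\<Omega>\<^sub>a\<close>, so \<open>\<mu>\<^sub>a\<close> divides a power of it and \<open>f(a)\<close> is integral.
  The condition is inherited by every element of \<open>K(X)\<close> integral over such \<open>f\<close>, because \<open>K[X]\<close> is
  integrally closed. Finally, finiteness of the residue rings yields, for each \<open>f\<close>, one monic \<open>\<phi> \<in> D[X]\<close>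
  with \<open>\<phi>(f)\<close> in all the rings \<open>D[X] + \<mu>\<^sub>a K[X]\<close> simultaneously.
\<close>

section \<open>Integral elements\<close>

text \<open>Gaussian elimination without division: each step doubles the degree \<open>k\<close> of the monic
  diagonal entries while keeping the other entries of smaller degree.\<close>

lemma monic_annihilator_of_linear_system:
  fixes act :: "'r::idom poly \<Rightarrow> 'm::ab_group_add \<Rightarrow> 'm"
  assumes "Modules.module act"
    and "finite I" and "i \<in> I"
    and "\<And>i. i \<in> I \<Longrightarrow> (\<Sum>j\<in>I. act (N i j) (e j)) = 0"
    and "\<And>i. i \<in> I \<Longrightarrow> lead_coeff (N i i) = 1 \<and> degree (N i i) = k"
    and "\<And>i j. i \<in> I \<Longrightarrow> j \<in> I \<Longrightarrow> i \<noteq> j \<Longrightarrow> degree (N i j) < k"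
  shows "\<exists>p. lead_coeff p = 1 \<and> act p (e i) = 0"
  using assms(2-)
proof (induction "card I" arbitrary: I N k)
  case 0
  then show ?case by auto
next
  case (Suc m)
  interpret Modules.module act by fact
  show ?case
  proof (cases "I = {i}")
    case True
    with Suc.prems show ?thesis by auto
  next
    case False
    with Suc.prems(2) obtain l where l: "l \<in> I" "l \<noteq> i" by auto
    define J where "J = I - {l}"
    have I: "I = insert l J" "l \<notin> J" "finite J" and iJ: "i \<in> J"
      using l Suc.prems by (auto simp: J_def)
    have kpos: "k > 0" using Suc.prems(5)[OF l(1) Suc.prems(2) l(2)] by auto
    define N' where "N' r j = N l l * N r j - N r l * N l j" for r j
    have sys: "(\<Sum>j\<in>J. act (N' r j) (e j)) = 0" if r: "r \<in> J" for r
    proof -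
      have 1: "act (N r l) (e l) + (\<Sum>j\<in>J. act (N r j) (e j)) = 0"
        using Suc.prems(3)[of r] r I by simp
      have 2: "act (N l l) (e l) + (\<Sum>j\<in>J. act (N l j) (e j)) = 0"
        using Suc.prems(3)[of l] I by simp
      have "(\<Sum>j\<in>J. act (N' r j) (e j)) =
          act (N l l) (\<Sum>j\<in>J. act (N r j) (e j)) - act (N r l) (\<Sum>j\<in>J. act (N l j) (e j))"
        by (simp add: N'_def scale_left_diff_distrib sum_subtractf scale_sum_right)
      also have "\<dots> = act (N l l) (- act (N r l) (e l)) - act (N r l) (- act (N l l) (e l))"
        using 1 2 by (simp only: add_eq_0_iff)
      also have "\<dots> = 0" by (simp add: mult.commute)
      finally show ?thesis .
    qed
    have small: "degree (N r l * N l j) < k + k" if "r \<in> J" "j \<in> J" for r j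
    proof -
      have "r \<noteq> l" "l \<noteq> j" using that I(2) by auto
      then have "degree (N r l) < k" "degree (N l j) < k"
        using Suc.prems(5) that l(1) by (auto simp: J_def)
      then show ?thesis using degree_mult_le[of "N r l" "N l j"] by linarith
    qed
    have diag: "lead_coeff (N' r r) = 1 \<and> degree (N' r r) = k + k" if r: "r \<in> J" for r
    proof -
      have rl: "lead_coeff (N r r) = 1" "degree (N r r) = k" "lead_coeff (N l l) = 1" "degree (N l l) = k"
        using Suc.prems(4)[of r] Suc.prems(4)[of l] r I by auto
      then have nz: "N r r \<noteq> 0" "N l l \<noteq> 0" by auto
      have d: "degree (N l l * N r r) = k + k" using nz rl by (simp add: degree_mult_eq)
      have lc: "lead_coeff (N l l * N r r) = 1" using rl by (simp only: lead_coeff_mult) simp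
      have s: "degree (- (N r l * N l r)) < degree (N l l * N r r)" using small[OF r r] d by simp
      have e: "N' r r = - (N r l * N l r) + N l l * N r r" by (simp add: N'_def)
      show ?thesis unfolding e using lead_coeff_add_le[OF s] degree_add_eq_right[OF s] lc d by simp
    qed
    have off: "degree (N' r j) < k + k" if "r \<in> J" "j \<in> J" "r \<noteq> j" for r j
    proof -
      have "degree (N l l * N r j) < k + k"
        using degree_mult_le[of "N l l" "N r j"] Suc.prems(5)[of r j] Suc.prems(4)[of l] that l(1)
        by (simp add: J_def)
      then show ?thesis unfolding N'_def using small[OF that(1,2)] by (rule degree_diff_less)
    qed
    have "m = card J" using Suc.hyps(2) I by simp
    from Suc.hyps(1)[OF this I(3) iJ sys diag off] show ?thesis .
  qed
qed

section \<open>Evaluation and integrality along a central ring homomorphism\<close>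

locale central_hom =
  fixes h :: "'r::idom \<Rightarrow> 'e::ring_1"
  assumes hom_add: "h (x + y) = h x + h y"
    and hom_mult: "h (x * y) = h x * h y"
    and hom_one: "h 1 = 1"
    and hom_comm: "h x * u = u * h x"
begin

lemma hom_left_comm: "u * (h x * v) = h x * (u * v)"
  by (metis hom_comm mult.assoc)

lemma hom_zero: "h 0 = 0"
  using hom_add[of 0 0] by simp

lemma hom_uminus: "h (- x) = - h x"
  using hom_add[of x "- x"] by (simp add: hom_zero eq_neg_iff_add_eq_0 add.commute)

sublocale mod: Modules.module "\<lambda>r x. h r * x"
  by unfold_locales (auto simp: hom_add hom_mult hom_one distrib_left distrib_right mult.assoc)

text \<open>The target may be noncommutative, as \<open>A\<close> and \<open>B\<close> are. Since
  the image of \<open>h\<close> is central, evaluation at a fixed element is still a ring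
  homomorphism on polynomials.\<close>

definition aeval :: "'r poly \<Rightarrow> 'e \<Rightarrow> 'e" where
  "aeval p x = (\<Sum>i\<le>degree p. h (coeff p i) * x ^ i)"

definition integral :: "'e \<Rightarrow> bool" where
  "integral x \<longleftrightarrow> (\<exists>p. lead_coeff p = 1 \<and> aeval p x = 0)"

lemma aeval_altdef: "degree p \<le> m \<Longrightarrow> aeval p x = (\<Sum>i\<le>m. h (coeff p i) * x ^ i)"
  unfolding aeval_def by (rule sum.mono_neutral_left) (auto simp: hom_zero coeff_eq_0)

lemma aeval_0 [simp]: "aeval 0 x = 0"
  by (simp add: aeval_def hom_zero)

lemma aeval_add: "aeval (p + q) x = aeval p x + aeval q x"
proof -
  let ?m = "max (degree p) (degree q)"
  have "degree (p + q) \<le> ?m" by (rule degree_add_le) auto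
  then show ?thesis
    by (simp add: aeval_altdef[of _ ?m] hom_add distrib_right sum.distrib)
qed

lemma aeval_pCons: "aeval (pCons c p) x = h c + x * aeval p x"
proof -
  have "aeval (pCons c p) x = (\<Sum>i\<le>Suc (degree p). h (coeff (pCons c p) i) * x ^ i)"
    by (rule aeval_altdef) (rule degree_pCons_le)
  also have "\<dots> = h c + (\<Sum>i\<le>degree p. h (coeff p i) * (x * x ^ i))"
    by (subst sum.atMost_Suc_shift) simp
  also have "(\<Sum>i\<le>degree p. h (coeff p i) * (x * x ^ i)) = x * aeval p x"
    unfolding aeval_def sum_distrib_left
    by (simp add: hom_left_comm)
  finally show ?thesis .
qed

lemma aeval_const [simp]: "aeval [:c:] x = h c"
  using aeval_pCons[of c 0] by simp

lemma aeval_1 [simp]: "aeval 1 x = 1"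
  by (simp add: one_pCons hom_one)

lemma aeval_smult: "aeval (smult c p) x = h c * aeval p x"
  by (induction p) (auto simp: aeval_pCons hom_mult distrib_left mult.assoc hom_left_comm)

lemma aeval_mult: "aeval (p * q) x = aeval p x * aeval q x"
  by (induction p) (auto simp: aeval_pCons aeval_add aeval_smult distrib_right mult.assoc hom_zero)

lemma aeval_uminus: "aeval (- p) x = - aeval p x"
  using aeval_add[of p "- p" x] by (simp add: eq_neg_iff_add_eq_0 add.commute)

lemma aeval_diff: "aeval (p - q) x = aeval p x - aeval q x"
  using aeval_add[of p "- q" x] by (simp add: aeval_uminus)

lemma aeval_power: "aeval (p ^ k) x = aeval p x ^ k"
  by (induction k) (auto simp: aeval_mult)

lemma aeval_X [simp]: "aeval [:0, 1:] x = x"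
  by (simp add: aeval_pCons hom_zero hom_one)

lemma aeval_monom: "aeval (monom c k) x = h c * x ^ k"
  by (simp add: monom_altdef aeval_smult aeval_power)

lemma aeval_pcompose: "aeval (pcompose p q) x = aeval p (aeval q x)"
  by (induction p) (auto simp: pcompose_pCons aeval_add aeval_mult aeval_pCons)

lemma aeval_dvd: "p dvd q \<Longrightarrow> aeval p x = 0 \<Longrightarrow> aeval q x = 0"
  by (auto simp: aeval_mult)

lemma aeval_sum: "aeval (sum f A) x = (\<Sum>i\<in>A. aeval (f i) x)"
  by (induction A rule: infinite_finite_induct) (auto simp: aeval_add)

text \<open>Scalars \<open>h c\<close> commute with \<open>x\<close>, so left multiplication by
  \<open>x\<close> is linear and can be checked on generators.\<close>

lemma mult_span:
  assumes "\<And>y. y \<in> S \<Longrightarrow> x * y \<in> mod.span T" and "y \<in> mod.span S"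
  shows "x * y \<in> mod.span T"
  using assms(2)
proof (induction rule: mod.span_induct_alt)
  case base
  show ?case by (simp add: mod.span_zero)
next
  case (step c y z)
  have "x * (h c * y + z) = h c * (x * y) + x * z"
    by (metis distrib_left hom_comm mult.assoc)
  then show ?case using step assms(1) by (simp add: mod.span_add mod.span_scale)
qed

text \<open>The Cayley-Hamilton argument: \<open>x\<close> acts on the generators through a matrix
  \<open>M\<close> over the base ring, so the generators solve the linear system with matrix
  \<open>X - M\<close>. Elimination gives each of them a monic annihilator, and the product of these
  kills \<open>1\<close>.\<close>

lemma integral_if_stable_span:
  assumes "finite S" and "1 \<in> mod.span S" and "\<And>y. y \<in> S \<Longrightarrow> x * y \<in> mod.span S"
  shows "integral x"
proof -
  have "\<forall>y\<in>S. \<exists>u. x * y = (\<Sum>z\<in>S. h (u z) * z)"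
    using assms(3) unfolding mod.span_finite[OF assms(1)] by blast
  then obtain M where M: "\<And>y. y \<in> S \<Longrightarrow> x * y = (\<Sum>z\<in>S. h (M y z) * z)" by metis
  \<comment> \<open>Polynomials act through evaluation at \<open>x\<close>. This turns
    \<open>'e\<close> into a module over the commutative ring \<open>'r poly\<close>, although
    \<open>'e\<close> itself need not be commutative.\<close>
  define act where "act p y = aeval p x * y" for p y
  have act: "Modules.module act"
    by unfold_locales (auto simp: act_def aeval_add aeval_mult distrib_left distrib_right mult.assoc)
  define N where "N y z = (if y = z then [:- M y z, 1:] else [:- M y z:])" for y z
  have sys: "(\<Sum>z\<in>S. act (N y z) z) = 0" if y: "y \<in> S" for y
  proof -
    have "act (N y z) z = (if z = y then x * z else 0) - h (M y z) * z" for z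
      by (auto simp: act_def N_def aeval_pCons hom_uminus hom_zero hom_one left_diff_distrib)
    then have "(\<Sum>z\<in>S. act (N y z) z) = x * y - (\<Sum>z\<in>S. h (M y z) * z)"
      using y assms(1) by (simp add: sum_subtractf)
    then show ?thesis using M[OF y] by simp
  qed
  have "\<exists>p. lead_coeff p = 1 \<and> act p y = 0" if "y \<in> S" for y
    using monic_annihilator_of_linear_system[OF act assms(1) that, of N "\<lambda>y. y" 1] sys
    by (auto simp: N_def)
  then obtain P where P: "\<And>y. y \<in> S \<Longrightarrow> lead_coeff (P y) = 1 \<and> act (P y) y = 0" by metis
  define p where "p = (\<Prod>y\<in>S. P y)"
  have "lead_coeff p = 1" using P by (simp add: p_def lead_coeff_prod)
  moreover have "aeval p x * y = 0" if "y \<in> S" for y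
  proof -
    have "p = (\<Prod>z\<in>S - {y}. P z) * P y"
      unfolding p_def using prod.remove[OF assms(1) that, of P] by (simp add: mult.commute)
    then show ?thesis using P[OF that] by (simp add: aeval_mult act_def mult.assoc)
  qed
  \<comment> \<open>The empty set spans only 0, so a multiplier that kills all generators kills
    \<open>1\<close> as well.\<close>
  then have "aeval p x * 1 \<in> mod.span {}" by (intro mult_span[OF _ assms(2)]) simp
  ultimately show ?thesis unfolding integral_def by auto
qed

end

lemma map_poly_mult_hom:
  fixes f :: "'a::comm_ring_1 \<Rightarrow> 'b::comm_ring_1"
  assumes "f 0 = 0" "\<And>x y. f (x + y) = f x + f y" "\<And>x y. f (x * y) = f x * f y"
  shows "map_poly f (p * q) = map_poly f p * map_poly f q"
proof -
  have "f (sum g A) = (\<Sum>x\<in>A. f (g x))" for g :: "nat \<Rightarrow> 'a" and A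
    by (induction A rule: infinite_finite_induct) (auto simp: assms)
  then show ?thesis
    by (intro poly_eqI) (simp add: coeff_map_poly coeff_mult assms)
qed

section \<open>Closure properties of integral elements in a commutative extension\<close>

locale comm_hom = central_hom h for h :: "'r::idom \<Rightarrow> 'e::comm_ring_1"
begin

lemma aeval_eq_poly: "aeval p x = poly (map_poly h p) x"
  by (induction p) (auto simp: aeval_pCons map_poly_pCons hom_zero)

lemma integral_hom: "integral (h c)"
  unfolding integral_def
  by (rule exI[of _ "[:- c, 1:]"]) (simp add: aeval_pCons hom_uminus hom_one)

text \<open>Elements stabilising one fixed span form a ring containing the image of
  \<open>h\<close>. A common finite \<open>S\<close> thus takes the place of the finitely generated
  subring containing several integral elements.\<close>

definition stable :: "'e set \<Rightarrow> 'e \<Rightarrow> bool" where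
  "stable S c \<longleftrightarrow> (\<forall>y\<in>S. c * y \<in> mod.span S)"

lemma stable_span: "stable S c \<Longrightarrow> y \<in> mod.span S \<Longrightarrow> c * y \<in> mod.span S"
  by (rule mult_span) (auto simp: stable_def)

lemma stable_add: "stable S c \<Longrightarrow> stable S d \<Longrightarrow> stable S (c + d)"
  by (auto simp: stable_def distrib_right intro: mod.span_add)

lemma stable_mult: "stable S c \<Longrightarrow> stable S d \<Longrightarrow> stable S (c * d)"
  using stable_span by (auto simp: stable_def mult.assoc)

lemma stable_hom: "stable S (h c)"
  by (auto simp: stable_def intro: mod.span_scale mod.span_base)

lemma integral_if_stable:
  assumes "finite S" "1 \<in> mod.span S" "stable S x"
  shows "integral x"
  using assms by (intro integral_if_stable_span) (auto simp: stable_def)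

text \<open>The generators are multiplied by the powers of \<open>x\<close> below
  \<open>degree p\<close>. The monic relation rewrites \<open>x ^ m\<close> through lower powers
  with coefficients that are absorbed by the span of \<open>S\<close>, and whatever stabilised
  \<open>S\<close> acts on the second factor only.\<close>

lemma adjoin_root_stable:
  assumes S: "finite S" "1 \<in> mod.span S"
    and p: "lead_coeff p = 1" "poly p x = 0" "\<And>i. stable S (coeff p i)"
  obtains S' where "finite S'" "1 \<in> mod.span S'" "stable S' x" "\<And>c. stable S c \<Longrightarrow> stable S' c"
proof -
  define m where "m = degree p"
  \<comment> \<open>A monic constant is 1 and has no root.\<close>
  have m: "m > 0"
  proof (rule ccontr)
    assume "\<not> m > 0"
    then have "degree p = 0" by (simp add: m_def)
    then obtain a where "p = [:a:]" by (rule degree_eq_zeroE)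
    with p show False by simp
  qed
  define S' where "S' = (\<lambda>(k, y). x ^ k * y) ` ({..<m} \<times> S)"
  have fin: "finite S'" using S by (simp add: S'_def)
  have mem: "x ^ k * y \<in> mod.span S'" if "k < m" "y \<in> mod.span S" for k y
    by (rule mult_span[OF _ that(2)]) (use that(1) in \<open>force simp: S'_def intro: mod.span_base\<close>)
  have xm: "x ^ m = (\<Sum>i<m. - (coeff p i * x ^ i))"
  proof -
    have "(\<Sum>i\<le>m. coeff p i * x ^ i) = 0" using p(2) by (simp add: poly_altdef m_def)
    then have "(\<Sum>i<m. coeff p i * x ^ i) + x ^ m = 0"
      using p(1) by (simp add: lessThan_Suc_atMost[symmetric] m_def)
    then show ?thesis by (simp only: sum_negf add_eq_0_iff)
  qed
  have "1 \<in> mod.span S'" using mem[OF m S(2)] by simp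
  moreover have "stable S' x"
    unfolding stable_def
  proof
    fix z assume "z \<in> S'"
    then obtain k y where ky: "k < m" "y \<in> S" "z = x ^ k * y" by (auto simp: S'_def)
    show "x * z \<in> mod.span S'"
    proof (cases "Suc k < m")
      case True
      with mem[of "Suc k" y] ky show ?thesis by (simp add: mod.span_base mult.assoc)
    next
      case False
      with ky have "Suc k = m" by simp
      then have "x * z = x ^ m * y" using ky by (auto simp: mult.assoc)
      also have "\<dots> = (\<Sum>i<m. - (x ^ i * (coeff p i * y)))"
        unfolding xm sum_distrib_right by (rule sum.cong) (auto simp: algebra_simps)
      also have "\<dots> \<in> mod.span S'"
        using p(3) ky by (auto intro!: mod.span_sum mod.span_neg mem simp: stable_def)
      finally show ?thesis .
    qed
  qed
  moreover have "stable S' c" if "stable S c" for c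
    unfolding stable_def
  proof
    fix z assume "z \<in> S'"
    then obtain k y where ky: "k < m" "y \<in> S" "z = x ^ k * y" by (auto simp: S'_def)
    have "x ^ k * (c * y) \<in> mod.span S'" using that ky by (intro mem) (auto simp: stable_def)
    then show "c * z \<in> mod.span S'" by (simp add: ky mult.left_commute)
  qed
  ultimately show thesis using fin by (intro that[of S'])
qed

text \<open>The construction starts from \<open>{1}\<close>, whose span is the image of
  \<open>h\<close>, and adjoins the elements one at a time.\<close>

lemma common_stable:
  assumes "finite C" "\<And>c. c \<in> C \<Longrightarrow> integral c"
  shows "\<exists>S. finite S \<and> 1 \<in> mod.span S \<and> (\<forall>c\<in>C. stable S c)"
  using assms
proof (induction C)
  case empty
  show ?case by (rule exI[of _ "{1}"]) (simp add: mod.span_base)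
next
  case (insert c C)
  then obtain S where S: "finite S" "1 \<in> mod.span S" "\<forall>c\<in>C. stable S c" by auto
  from insert.prems obtain p where p: "lead_coeff p = 1" "aeval p c = 0"
    unfolding integral_def by auto
  have "lead_coeff (map_poly h p) = 1"
    using p(1) by (subst lead_coeff_map_poly_nz) (auto simp: hom_one hom_zero)
  moreover have "poly (map_poly h p) c = 0" using p(2) by (simp add: aeval_eq_poly)
  moreover have "stable S (coeff (map_poly h p) i)" for i
    by (simp add: coeff_map_poly hom_zero stable_hom)
  ultimately obtain S' where "finite S'" "1 \<in> mod.span S'" "stable S' c"
    "\<And>d. stable S d \<Longrightarrow> stable S' d"
    by (rule adjoin_root_stable[OF S(1,2)]) blast
  then show ?case using S(3) by (intro exI[of _ S']) auto
qed

lemma integral_add: assumes "integral x" "integral y" shows "integral (x + y)"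
proof -
  obtain S where "finite S" "1 \<in> mod.span S" "stable S x" "stable S y"
    using common_stable[of "{x, y}"] assms by auto
  then show ?thesis by (intro integral_if_stable[of S] stable_add)
qed

lemma integral_mult: assumes "integral x" "integral y" shows "integral (x * y)"
proof -
  obtain S where "finite S" "1 \<in> mod.span S" "stable S x" "stable S y"
    using common_stable[of "{x, y}"] assms by auto
  then show ?thesis by (intro integral_if_stable[of S] stable_mult)
qed

lemma integral_0: "integral 0" and integral_1: "integral 1"
  using integral_hom[of 0] integral_hom[of 1] by (simp_all add: hom_zero hom_one)

lemma integral_uminus: "integral x \<Longrightarrow> integral (- x)"
  using integral_mult[OF integral_hom[of "- 1"], of x] by (simp add: hom_uminus hom_one)

lemma integral_sum: "(\<And>i. i \<in> I \<Longrightarrow> integral (f i)) \<Longrightarrow> integral (sum f I)"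
  by (induction I rule: infinite_finite_induct) (auto simp: integral_0 integral_add)

text \<open>Transitivity of integrality: the finitely many coefficients stabilise one finitely
  generated span, and adjoining \<open>x\<close> keeps it finitely generated.\<close>

lemma integral_trans:
  assumes "lead_coeff p = 1" "poly p x = 0" "\<And>i. integral (coeff p i)"
  shows "integral x"
proof -
  have "range (coeff p) \<subseteq> insert 0 (coeff p ` {..degree p})"
    using le_degree by blast
  then have fin: "finite (range (coeff p))" by (rule finite_subset) simp
  obtain S where "finite S" "1 \<in> mod.span S" "\<And>i. stable S (coeff p i)"
    using common_stable[OF fin] assms(3) by auto
  from adjoin_root_stable[OF this(1,2) assms(1,2) this(3)] show ?thesis
    by (metis integral_if_stable)
qed

lemma integral_coeff_mult:
  assumes "\<And>i. integral (coeff p i)" "\<And>i. integral (coeff q i)"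
  shows "integral (coeff (p * q) i)"
  unfolding coeff_mult by (intro integral_sum integral_mult assms)

lemma integral_coeff_linear_factors:
  assumes "\<And>\<alpha>. \<alpha> \<in># A \<Longrightarrow> integral \<alpha>"
  shows "integral (coeff (\<Prod>\<alpha>\<in>#A. [:- \<alpha>, 1:]) i)"
  using assms
proof (induction A arbitrary: i)
  case empty
  show ?case by (auto simp: one_pCons coeff_pCons integral_0 integral_1 split: nat.splits)
next
  case (add \<alpha> A)
  have "integral (coeff [:- \<alpha>, 1:] j)" for j
    using add.prems by (auto simp: coeff_pCons integral_0 integral_1 integral_uminus split: nat.splits)
  then show ?case
    using add by (simp only: image_mset_add_mset prod_mset.add_mset)
      (intro integral_coeff_mult, auto)
qed

end

text \<open>The polynomial splits into linear factors, and up to sign its coefficients are sums of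
  products of its roots.\<close>

lemma integral_coeff_of_integral_roots:
  fixes h :: "'r::idom \<Rightarrow> 'e::alg_closed_field"
  assumes "comm_hom h" and "lead_coeff p = 1"
    and "\<And>\<alpha>. poly p \<alpha> = 0 \<Longrightarrow> central_hom.integral h \<alpha>"
  shows "central_hom.integral h (coeff p i)"
proof -
  interpret comm_hom h by fact
  from assms(2) have "p \<noteq> 0" by auto
  then obtain A where A: "p = (\<Prod>\<alpha>\<in>#A. [:- \<alpha>, 1:])"
    using alg_closed_imp_factorization[of p] assms(2) by auto
  have "poly p \<alpha> = 0" if "\<alpha> \<in># A" for \<alpha>
    unfolding A poly_prod_mset using that by (auto simp: prod_mset_zero_iff image_iff)
  with assms(3) show ?thesis
    by (subst A) (rule integral_coeff_linear_factors, auto)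
qed

text \<open>Each root of \<open>p\<close> gives a linear factor of \<open>q\<close>. Counted with
  multiplicity, \<open>p\<close> has \<open>degree p\<close> linear factors, and each is absorbed by
  one copy of \<open>q\<close>.\<close>

lemma dvd_power_if_roots:
  fixes p q :: "'e::alg_closed_field poly"
  assumes "p \<noteq> 0" and "\<And>\<alpha>. poly p \<alpha> = 0 \<Longrightarrow> poly q \<alpha> = 0"
  shows "p dvd q ^ degree p"
proof -
  obtain A where A: "size A = degree p" "p = smult (lead_coeff p) (\<Prod>x\<in>#A. [:-x, 1:])"
    using alg_closed_imp_factorization[OF assms(1)] by auto
  have root: "poly p \<alpha> = 0" if "\<alpha> \<in># A" for \<alpha>
    by (subst A(2)) (use that in \<open>auto simp: poly_prod_mset prod_mset_zero_iff image_iff\<close>)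
  have "(\<Prod>x\<in>#C. [:-x, 1:]) dvd q ^ size C" if "C \<subseteq># A" for C
    using that
  proof (induction C)
    case (add \<alpha> C)
    have "\<alpha> \<in># A" using add.prems by (meson mset_subset_eqD union_single_eq_member)
    then have "[:- \<alpha>, 1:] dvd q" using root assms(2) by (simp add: poly_eq_0_iff_dvd)
    moreover have "C \<subseteq># A" using add.prems subset_mset.dual_order.trans[OF add.prems] by auto
    ultimately show ?case
      using mult_dvd_mono[OF _ add.IH] by (simp only: image_mset_add_mset prod_mset.add_mset size_add_mset power_Suc)
  qed auto
  from this[of A] have "(\<Prod>x\<in>#A. [:-x, 1:]) dvd q ^ degree p" using A(1) by simp
  then show ?thesis using assms(1) by (subst A(2)) (simp add: smult_dvd_iff)
qed

section \<open>Descent of divisibility from the algebraic closure to \<open>K\<close>\<close>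

lemma map_poly_to_ac_mult: "map_poly to_ac (p * q) = map_poly to_ac p * map_poly to_ac q"
  by (rule map_poly_mult_hom) auto

lemma map_poly_to_ac_add: "map_poly to_ac (p + q) = map_poly to_ac p + map_poly to_ac q"
  by (rule poly_eqI) (simp add: coeff_map_poly)

lemma map_poly_to_ac_power: "map_poly to_ac (p ^ k) = map_poly to_ac p ^ k"
  by (induction k) (auto simp: map_poly_to_ac_mult)

text \<open>Division with remainder over \<open>K\<close> is preserved by the embedding, and a
  remainder divisible by \<open>p\<close> in the larger ring vanishes for degree reasons.\<close>

lemma map_poly_to_ac_dvd:
  assumes "map_poly to_ac p dvd map_poly to_ac q"
  shows "p dvd q"
proof (cases "p = 0")
  case True
  with assms show ?thesis by (simp add: map_poly_eq_0_iff)
next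
  case False
  have "q = p * (q div p) + q mod p" by simp
  then have "map_poly to_ac q = map_poly to_ac p * map_poly to_ac (q div p) + map_poly to_ac (q mod p)"
    by (metis map_poly_to_ac_add map_poly_to_ac_mult)
  with assms have dvd: "map_poly to_ac p dvd map_poly to_ac (q mod p)"
    by (metis dvd_add_right_iff dvd_triv_left)
  have "q mod p = 0"
  proof (rule ccontr)
    assume nz: "q mod p \<noteq> 0"
    then have "map_poly to_ac (q mod p) \<noteq> 0" by (simp add: map_poly_eq_0_iff)
    from dvd_imp_degree_le[OF dvd this] have "degree p \<le> degree (q mod p)"
      by (simp add: degree_map_poly)
    with degree_mod_less[OF False, of q] nz show False by auto
  qed
  then show ?thesis by (simp add: dvd_eq_mod_eq_0)
qed

lemma dvd_power_if_alg_closure_roots: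
  assumes "p \<noteq> 0"
    and "\<And>\<alpha>. poly (map_poly to_ac p) \<alpha> = 0 \<Longrightarrow> poly (map_poly to_ac q) \<alpha> = 0"
  shows "p dvd q ^ degree p"
proof -
  have "map_poly to_ac p dvd map_poly to_ac q ^ degree (map_poly to_ac p)"
    using assms by (intro dvd_power_if_roots) (auto simp: map_poly_eq_0_iff)
  then have "map_poly to_ac p dvd map_poly to_ac (q ^ degree p)"
    by (simp add: degree_map_poly map_poly_to_ac_power)
  then show ?thesis by (rule map_poly_to_ac_dvd)
qed

section \<open>Euclidean rings are integrally closed\<close>

lemma bezout:
  fixes x y :: "'a::euclidean_ring"
  shows "\<exists>g a b. g = a * x + b * y \<and> g dvd x \<and> g dvd y"
proof (induction "euclidean_size y" arbitrary: x y rule: less_induct)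
  case less
  show ?case
  proof (cases "y = 0")
    case True
    then show ?thesis by (intro exI[of _ x] exI[of _ 1] exI[of _ 0]) auto
  next
    case False
    from less[OF mod_size_less[OF this], of y x] obtain g a b
      where g: "g = a * y + b * (x mod y)" "g dvd y" "g dvd x mod y" by blast
    have "g = b * x + (a - b * (x div y)) * y"
      unfolding g(1) minus_div_mult_eq_mod[symmetric] by (simp add: algebra_simps)
    moreover have "g dvd x" using g by (metis dvd_mod_iff)
    ultimately show ?thesis using g(2) by blast
  qed
qed

lemma coprime_fract_representation:
  fixes z :: "'a::euclidean_ring fract"
  obtains x y a b where "z = Fract x y" "y \<noteq> 0" "a * x + b * y = 1"
proof -
  obtain x y where z: "z = Fract x y" "y \<noteq> 0" by (cases z) auto
  obtain g a b where g: "g = a * x + b * y" "g dvd x" "g dvd y" using bezout[of x y] by blast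
  from g(2,3) obtain x' y' where xy: "x = g * x'" "y = g * y'" unfolding dvd_def by blast
  with z have "g \<noteq> 0" "y' \<noteq> 0" by auto
  moreover have "g * (a * x' + b * y') = g * 1" using g(1) xy by (simp add: algebra_simps)
  ultimately have "a * x' + b * y' = 1" by simp
  moreover have "z = Fract x' y'"
    using z xy \<open>y' \<noteq> 0\<close> by (simp add: eq_fract)
  ultimately show thesis using that \<open>y' \<noteq> 0\<close> by blast
qed

lemma to_fract_power: "to_fract (x ^ k) = to_fract x ^ k"
  by (induction k) auto

text \<open>The rational root argument: with \<open>z = x / y\<close> in lowest terms, clearing
  denominators in the monic equation gives \<open>y dvd x ^ m\<close>, so \<open>y\<close> is a
  unit. It is applied later to \<open>K[X]\<close>.\<close>

lemma integrally_closed_euclidean_ring: "integrally_closed TYPE('a::euclidean_ring)"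
proof -
  have "z \<in> range to_fract" if z: "integral_over (range to_fract) z" for z :: "'a fract"
  proof -
    obtain p where p: "lead_coeff p = 1" "\<And>i. coeff p i \<in> range to_fract" "poly p z = 0"
      using z by (auto simp: integral_over_def)
    then have "\<forall>i. \<exists>c. coeff p i = to_fract c" by blast
    then obtain c where c: "\<And>i. coeff p i = to_fract (c i)" by metis
    obtain x y a b where xy: "z = Fract x y" "y \<noteq> 0" "a * x + b * y = 1"
      by (rule coprime_fract_representation)
    define m where "m = degree p"
    have zy: "to_fract y * z = to_fract x" using xy by (simp add: Fract_conv_to_fract)
    have "to_fract (\<Sum>i\<le>m. c i * x ^ i * y ^ (m - i)) = to_fract y ^ m * (\<Sum>i\<le>m. coeff p i * z ^ i)"
      unfolding sum_distrib_left to_fract_sum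
    proof (rule sum.cong)
      fix i assume "i \<in> {..m}"
      then have "to_fract y ^ m = to_fract y ^ i * to_fract y ^ (m - i)"
        by (simp add: power_add[symmetric])
      then show "to_fract (c i * x ^ i * y ^ (m - i)) = to_fract y ^ m * (coeff p i * z ^ i)"
        by (simp add: to_fract_power c zy[symmetric] power_mult_distrib algebra_simps)
    qed simp
    also have "(\<Sum>i\<le>m. coeff p i * z ^ i) = 0" using p(3) by (simp add: poly_altdef m_def)
    finally have "(\<Sum>i\<le>m. c i * x ^ i * y ^ (m - i)) = 0"
      by (simp only: mult_zero_right to_fract_eq_0_iff)
    moreover have "c m = 1" using c[of m] p(1) by (simp add: m_def flip: to_fract_1)
    ultimately have "(\<Sum>i<m. c i * x ^ i * y ^ (m - i)) + x ^ m = 0"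
      by (simp add: lessThan_Suc_atMost[symmetric])
    then have "x ^ m = - (\<Sum>i<m. c i * x ^ i * y ^ (m - i))"
      by (simp only: add_eq_0_iff)
    moreover have "y dvd (\<Sum>i<m. c i * x ^ i * y ^ (m - i))"
      by (rule dvd_sum) (auto intro!: dvd_mult dvd_power)
    ultimately have "y dvd x ^ m" by simp
    \<comment> \<open>The Bezout relation times \<open>x ^ k\<close> lowers the exponent by one,
      down to \<open>y dvd 1\<close>.\<close>
    moreover have "y dvd x ^ k \<Longrightarrow> y dvd 1" for k
    proof (induction k)
      case (Suc k)
      have "x ^ k = a * x ^ Suc k + b * x ^ k * y"
        using arg_cong[OF xy(3), of "\<lambda>u. x ^ k * u"] by (simp add: algebra_simps)
      then show ?case using Suc by (metis dvd_add dvd_mult dvd_triv_right)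
    qed simp
    ultimately have "y dvd 1" by blast
    then obtain w where "1 = y * w" by (rule dvdE)
    then have "x = x * w * y" by (metis mult.assoc mult.commute mult_1_right)
    then have "z = to_fract (x * w)" using xy(1,2) by (simp add: to_fract_def eq_fract)
    then show ?thesis by blast
  qed
  moreover have "integral_over (range to_fract) (to_fract x)" for x :: 'a
    unfolding integral_over_def
    by (rule exI[of _ "[:- to_fract x, 1:]"])
      (auto simp: coeff_pCons split: nat.splits intro: range_eqI[of _ _ "- x"] range_eqI[of _ _ 0] range_eqI[of _ _ 1])
  moreover have "to_fract x \<in> quotient_field_of UNIV" for x :: 'a
    unfolding quotient_field_of_def to_fract_def by (intro CollectI exI conjI refl) auto
  ultimately show ?thesis
    unfolding integrally_closed_def integral_closure_def by blast
qed

section \<open>Base change to the quotient field\<close>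

lemma tensor_lift_eq_sum:
  assumes "finite T" "Poly_Mapping.keys F \<subseteq> T"
  shows "tensor_lift t F = (\<Sum>(x, y)\<in>T. of_int (Poly_Mapping.lookup F (x, y)) * t x y)"
  unfolding tensor_lift_def using assms
  by (intro sum.mono_neutral_left) (auto simp: in_keys_iff)

lemma tensor_lift_frag_of: "tensor_lift t (frag_of (x, y)) = t x y"
  by (simp add: tensor_lift_def)

lemma tensor_lift_diff: "tensor_lift t (F - G) = tensor_lift t F - tensor_lift t G"
proof -
  let ?T = "Poly_Mapping.keys F \<union> Poly_Mapping.keys G"
  have "Poly_Mapping.keys (F - G) \<subseteq> ?T" by (rule keys_diff)
  then show ?thesis
    by (simp add: tensor_lift_eq_sum[of ?T] lookup_minus left_diff_distrib case_prod_unfold sum_subtractf)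
qed

locale base_change =
  fixes scale :: "'d::idom \<Rightarrow> 'a::ring_1 \<Rightarrow> 'a"
    and t :: "'a \<Rightarrow> 'd fract \<Rightarrow> 'b::ring_1"
  assumes alg: "unital_algebra scale"
    and fg: "finitely_generated scale"
    and bc: "is_base_change_to_fract scale t"
begin

lemma t_one: "t 1 1 = 1"
  and t_mult: "t x k * t y l = t (x * y) (k * l)"
  using bc by (auto simp: is_base_change_to_fract_def)

lemma t_relation: "F \<in> tensor_relations scale (\<lambda>d k. to_fract d * k) \<Longrightarrow> tensor_lift t F = 0"
  using bc by (auto simp: is_base_change_to_fract_def is_tensor_product_def)

lemma t_add_left: "t (x + x') k = t x k + t x' k"
  using t_relation[OF tensor_relations.add_left[of x x' k]]
  by (simp only: tensor_lift_diff tensor_lift_frag_of) (simp add: algebra_simps)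

lemma t_zero_left: "t 0 k = 0"
  using t_add_left[of 0 0 k] by simp

lemma t_add_right: "t x (k + k') = t x k + t x k'"
  using t_relation[OF tensor_relations.add_right[of x k k']]
  by (simp only: tensor_lift_diff tensor_lift_frag_of) (simp add: algebra_simps)

lemma t_scale: "t (scale d x) k = t x (to_fract d * k)"
  using t_relation[OF tensor_relations.balanced[of _ d x k]]
  by (simp add: tensor_lift_diff tensor_lift_frag_of)

text \<open>Surjectivity of \<open>tensor_lift t\<close> says that the pure tensors generate
  \<open>B\<close> as an additive group; integer multiples reduce to sums and negation.\<close>

lemma pure_tensor_induct [case_names pure zero add minus]:
  assumes "\<And>x k. P (t x k)" "P 0" "\<And>u v. P u \<Longrightarrow> P v \<Longrightarrow> P (u + v)" "\<And>u. P u \<Longrightarrow> P (- u)"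
  shows "P b"
proof -
  have "surj (tensor_lift t)"
    using bc by (auto simp: is_base_change_to_fract_def is_tensor_product_def)
  then obtain F where F: "b = tensor_lift t F" by (auto simp: surj_def)
  have nat: "P (of_nat m * u)" if "P u" for m u
    by (induction m) (auto simp: assms that distrib_right)
  have int: "P (of_int m * u)" if "P u" for m u
    by (cases m) (auto simp: nat assms(4) that simp flip: of_nat_Suc)
  have "P (sum f A)" if "\<And>x. P (f x)" for f and A :: "('a \<times> 'd fract) set"
    by (induction A rule: infinite_finite_induct) (auto simp: assms that)
  then show ?thesis unfolding F tensor_lift_def
    by (auto simp: case_prod_unfold int assms(1))
qed

sublocale A: unital_algebra scale by (rule alg)

sublocale DA: central_hom "\<lambda>d. scale d 1"
proof unfold_locales
  fix x y
  show "scale (x * y) 1 = scale x 1 * scale y 1"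
    by (simp add: A.scale_mult_left)
qed (simp_all add: A.scale_left_distrib A.scale_mult_left A.scale_mult_right)

text \<open>On pure tensors centrality comes from the commutativity of \<open>K\<close>, and it
  extends additively to all of \<open>B\<close>.\<close>

sublocale KB: central_hom "t 1"
proof unfold_locales
  fix k u
  show "t 1 k * u = u * t 1 k"
    by (induction u rule: pure_tensor_induct)
      (simp_all add: t_mult mult.commute distrib_left distrib_right)
qed (simp_all add: t_add_right t_mult t_one)

lemma eval_B_eq: "eval_B t = KB.aeval"
  by (simp add: fun_eq_iff eval_B_def K_scale_def KB.aeval_def)

lemma aeval_A: "KB.aeval (map_poly to_fract p) (t a 1) = t (DA.aeval p a) 1"
proof (induction p)
  case 0
  show ?case by (simp add: t_zero_left)
next
  case (pCons c p)
  then show ?case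
    by (simp add: map_poly_pCons KB.aeval_pCons DA.aeval_pCons t_add_left t_scale t_mult)
qed

text \<open>A finite generating set spans all of \<open>A\<close>, so its span is trivially stable
  under multiplication by \<open>a\<close>.\<close>

lemma integral_A: "DA.integral a"
proof -
  obtain S where S: "finite S" "Modules.module.span scale S = UNIV"
    using fg by (auto simp: finitely_generated_def)
  have "(\<lambda>r x. scale r 1 * x) = scale" by (simp add: fun_eq_iff A.scale_mult_left)
  with S have "DA.mod.span S = UNIV" by simp
  with S(1) show ?thesis by (intro DA.integral_if_stable_span) auto
qed

lemma A_subset_A': "A_in_B t \<subseteq> A' t"
proof -
  have "t a 1 \<in> A' t" for a
  proof -
    obtain p where "lead_coeff p = 1" "DA.aeval p a = 0"
      using integral_A[of a] by (auto simp: DA.integral_def)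
    then show ?thesis by (auto simp: A'_def eval_B_eq aeval_A t_zero_left)
  qed
  then show ?thesis by (auto simp: A_in_B_def)
qed

lemma eval_in_A:
  assumes "a \<in> A_in_B t"
  shows "KB.aeval (map_poly to_fract g) a \<in> A_in_B t"
  using assms by (auto simp: A_in_B_def aeval_A)

section \<open>\<open>B\<close> as a finite-dimensional vector space over \<open>K\<close>\<close>

lemma vector_space_B: "vector_space (K_scale t)"
  using KB.mod.module_axioms by (simp add: K_scale_def[abs_def] vector_space_def Modules.module_def)

text \<open>Generators of \<open>A\<close> over \<open>D\<close> also span \<open>B\<close> over
  \<open>K\<close>, because \<open>t x k\<close> is a scalar multiple of
  \<open>t x 1\<close>.\<close>

lemma finite_dimensional_B:
  obtains W where "finite W" "Modules.module.span (K_scale t) W = UNIV"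
proof -
  obtain S where S: "finite S" "A.span S = UNIV"
    using fg by (auto simp: finitely_generated_def)
  define W where "W = (\<lambda>s. t s 1) ` S"
  have pure: "t x k \<in> KB.mod.span W" for x k
  proof -
    have "x \<in> A.span S" using S by simp
    then have "t x 1 \<in> KB.mod.span W"
    proof (induction rule: A.span_induct_alt)
      case base
      show ?case by (simp add: t_zero_left KB.mod.span_zero)
    next
      case (step c y z)
      have "t (scale c y + z) 1 = t 1 (to_fract c) * t y 1 + t z 1"
        by (simp add: t_add_left t_scale t_mult)
      moreover have "t y 1 \<in> KB.mod.span W"
        using step by (auto simp: W_def intro: KB.mod.span_base)
      ultimately show ?case using step by (simp add: KB.mod.span_add KB.mod.span_scale)
    qed
    then have "t 1 k * t x 1 \<in> KB.mod.span W" by (rule KB.mod.span_scale)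
    then show ?thesis by (simp add: t_mult)
  qed
  have "b \<in> KB.mod.span W" for b
    by (induction b rule: pure_tensor_induct)
      (auto simp: pure KB.mod.span_zero KB.mod.span_add KB.mod.span_neg)
  then have "KB.mod.span W = UNIV" by auto
  then show thesis using S(1) by (intro that[of W]) (auto simp: W_def K_scale_def[abs_def])
qed

text \<open>The \<open>n + 1\<close> powers of \<open>b\<close> with exponents up to
  \<open>n = dim_B t\<close> are linearly dependent.\<close>

lemma annihilator_degree_le_dim:
  "\<exists>p. p \<noteq> 0 \<and> degree p \<le> dim_B t \<and> KB.aeval p b = 0"
proof -
  interpret V: vector_space "K_scale t" by (rule vector_space_B)
  let ?n = "dim_B t"
  show ?thesis
  \<comment> \<open>Coinciding powers would form too small a set for the dimension count, but then a
    difference of two monomials already annihilates \<open>b\<close>.\<close>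
  proof (cases "inj_on (\<lambda>i. b ^ i) {..?n}")
    case False
    then obtain i j where ij: "i \<noteq> j" "i \<le> ?n" "j \<le> ?n" "b ^ i = b ^ j"
      by (auto simp: inj_on_def)
    define p where "p = monom (1 :: 'd fract) i - monom 1 j"
    have "coeff p i = 1" using ij by (simp add: p_def)
    then have "p \<noteq> 0" by auto
    moreover have "degree p \<le> ?n"
      unfolding p_def using ij by (intro degree_diff_le) (auto intro: order.trans[OF degree_monom_le])
    moreover have "KB.aeval p b = 0"
      using ij by (simp add: p_def KB.aeval_diff KB.aeval_monom)
    ultimately show ?thesis by blast
  next
    case True
    define S where "S = (\<lambda>i. b ^ i) ` {..?n}"
    have card: "card S = Suc ?n" using card_image[OF True] by (simp add: S_def)
    obtain W where W: "finite W" "V.span W = UNIV" by (rule finite_dimensional_B)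
    obtain C where C: "V.independent C" "V.span C = UNIV" "card C = ?n"
      using V.basis_exists[of UNIV] unfolding dim_B_def by (metis top.extremum_uniqueI)
    \<comment> \<open>\<open>card\<close> of an infinite set is 0, so the basis has to be known
      finite before \<open>card C\<close> can bound independent sets.\<close>
    have "finite C" using V.independent_span_bound[OF W(1) C(1)] W(2) by auto
    then have "V.dependent S"
      using V.independent_span_bound[of C S] C card by auto
    then obtain u where u: "\<exists>v\<in>S. u v \<noteq> 0" "(\<Sum>v\<in>S. K_scale t (u v) v) = 0"
      using V.dependent_finite[of S] by (auto simp: S_def)
    define p where "p = (\<Sum>i\<le>?n. monom (u (b ^ i)) i)"
    have "coeff p i = u (b ^ i)" if "i \<le> ?n" for i
      using that by (simp add: p_def coeff_sum)
    with u(1) have "p \<noteq> 0" by (auto simp: S_def)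
    moreover have "degree p \<le> ?n"
      unfolding p_def by (intro degree_sum_le) (auto intro: order.trans[OF degree_monom_le])
    moreover have "KB.aeval p b = (\<Sum>i\<le>?n. K_scale t (u (b ^ i)) (b ^ i))"
      by (simp add: p_def KB.aeval_sum KB.aeval_monom K_scale_def)
    then have "KB.aeval p b = 0"
      using u(2) unfolding S_def by (simp add: sum.reindex[OF True])
    ultimately show ?thesis by blast
  qed
qed

end

text \<open>A nonzero annihilator of least degree, made monic, divides every other one, since a
  nonzero remainder would have smaller degree. This is the existence half behind
  \<open>min_poly\<close>.\<close>

lemma zero_set_principal:
  fixes h :: "'k::field \<Rightarrow> 'e::ring_1"
  assumes "central_hom h" and "p \<noteq> 0" "central_hom.aeval h p x = 0"
  shows "\<exists>q. lead_coeff q = 1 \<and> {f. central_hom.aeval h f x = 0} = {f. q dvd f}"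
proof -
  interpret central_hom h by fact
  obtain r where r: "r \<noteq> 0" "aeval r x = 0"
    and least: "\<And>f. f \<noteq> 0 \<Longrightarrow> aeval f x = 0 \<Longrightarrow> degree r \<le> degree f"
    using ex_has_least_nat[of "\<lambda>f. f \<noteq> 0 \<and> aeval f x = 0" p degree] assms(2,3) by blast
  define q where "q = smult (inverse (lead_coeff r)) r"
  have q: "lead_coeff q = 1" "aeval q x = 0" "degree q = degree r" "q \<noteq> 0"
    using r by (auto simp: q_def aeval_smult)
  have "q dvd f" if "aeval f x = 0" for f
  proof (rule ccontr)
    assume "\<not> q dvd f"
    then have nz: "f mod q \<noteq> 0" by (simp add: dvd_eq_mod_eq_0)
    have "aeval (q * (f div q) + f mod q) x = 0" using that by simp
    then have "aeval (f mod q) x = 0" using q(2) by (simp only: aeval_add aeval_mult) simp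
    from least[OF nz this] have "degree q \<le> degree (f mod q)" using q by simp
    with degree_mod_less[OF q(4), of f] nz show False by auto
  qed
  then show ?thesis using q by (intro exI[of _ q]) (auto intro: aeval_dvd)
qed

section \<open>Denominators and residues\<close>

lemma monic_dvd_antisym:
  fixes p q :: "'r::idom poly"
  assumes "p dvd q" "q dvd p" "lead_coeff p = 1" "lead_coeff q = 1"
  shows "p = q"
proof -
  obtain r where r: "q = p * r" using assms(1) by (rule dvdE)
  have nz: "p \<noteq> 0" "q \<noteq> 0" using assms(3,4) by auto
  with r have "degree q = degree p + degree r" by (auto intro: degree_mult_eq)
  moreover have "degree q \<le> degree p" using assms(2) nz(1) by (rule dvd_imp_degree_le)
  ultimately have "degree r = 0" by simp
  moreover have "lead_coeff r = 1" using assms(3,4) by (simp add: r lead_coeff_mult)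
  ultimately have "r = 1" by (metis degree_eq_zeroE lead_coeff_pCons(2) one_pCons)
  then show ?thesis by (simp add: r)
qed

text \<open>Pseudo-division scales the dividend by a power of the leading coefficient, which is 1
  here.\<close>

lemma monic_division:
  fixes m :: "'r::idom poly"
  assumes "lead_coeff m = 1"
  obtains q r where "p = m * q + r" "r = 0 \<or> degree r < degree m"
proof -
  have "m \<noteq> 0" using assms by auto
  moreover obtain q r where "pseudo_divmod p m = (q, r)" by (cases "pseudo_divmod p m")
  ultimately show thesis using pseudo_divmod[of m p q r] assms that by auto
qed

lemma clear_denominators:
  fixes f :: "'d::idom fract poly"
  obtains d g where "d \<noteq> 0" "smult (to_fract d) f = map_poly to_fract g"
proof -
  have "\<exists>d g. d \<noteq> 0 \<and> smult (to_fract d) f = map_poly to_fract g"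
  proof (induction f)
    case 0
    show ?case by (intro exI[of _ 1] exI[of _ 0]) simp
  next
    case (pCons c f)
    then obtain d g where dg: "d \<noteq> 0" "smult (to_fract d) f = map_poly to_fract g" by blast
    obtain x y where xy: "c = to_fract x / to_fract y" "y \<noteq> 0"
      by (cases c) (simp add: Fract_conv_to_fract)
    have "smult (to_fract (y * d)) (pCons c f) = map_poly to_fract (pCons (x * d) (smult y g))"
      using xy dg(2) by (simp add: map_poly_pCons flip: smult_smult)
    then show ?case using dg(1) xy(2) by (intro exI[of _ "y * d"]) auto
  qed
  then show thesis using that by blast
qed

text \<open>In Horner's scheme each multiplication by \<open>f\<close> is paired with one factor
  \<open>d\<close>, and at most \<open>n\<close> of them occur.\<close>

lemma clear_denominators_pcompose:
  assumes "smult (to_fract d) f = map_poly to_fract g" and "degree s \<le> n"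
  shows "\<exists>u. smult (to_fract d ^ n) (pcompose (map_poly to_fract s) f) = map_poly to_fract u"
  using assms(2)
proof (induction s arbitrary: n)
  case 0
  show ?case by (intro exI[of _ 0]) simp
next
  case (pCons c s)
  show ?case
  proof (cases "s = 0")
    case True
    then show ?thesis
      by (intro exI[of _ "[:d ^ n * c:]"]) (simp add: map_poly_pCons pcompose_pCons to_fract_power)
  next
    case False
    then obtain k where n: "n = Suc k" "degree s \<le> k" using pCons.prems by (cases n) auto
    from pCons.IH[OF n(2)] obtain u
      where u: "smult (to_fract d ^ k) (pcompose (map_poly to_fract s) f) = map_poly to_fract u" by blast
    have "smult (to_fract d ^ n) (pcompose (map_poly to_fract (pCons c s)) f) =
        [:to_fract (d ^ n * c):] +
        smult (to_fract d) f * smult (to_fract d ^ k) (pcompose (map_poly to_fract s) f)"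
      by (simp add: map_poly_pCons pcompose_pCons smult_add_right n(1) to_fract_power mult.commute)
    also have "\<dots> = map_poly to_fract ([:d ^ n * c:] + g * u)"
      unfolding u assms(1) by (simp add: map_poly_pCons)
    finally show ?thesis by blast
  qed
qed

lemma finite_residues:
  fixes c :: "'d::idom"
  assumes "finite_residue_rings TYPE('d)" and "c \<noteq> 0"
  obtains T where "finite T" "\<And>x. \<exists>y\<in>T. c dvd x - y"
\<comment> \<open>The hypothesis concerns proper ideals only; for a unit \<open>c\<close> the single
  residue 0 suffices.\<close>
proof (cases "c dvd 1")
  case True
  then have "c dvd x - 0" for x by (metis dvd_trans one_dvd)
  then show thesis by (intro that[of "{0}"]) auto
next
  case False
  let ?R = "ring_of_type_algebra :: 'd ring"
  define I where "I = {x. c dvd x}"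
  interpret R: ring ?R by (rule ring_from_type_algebra)
  have "ideal I ?R"
  proof (rule idealI[OF R.ring_axioms])
    show "subgroup I (add_monoid ?R)"
    proof (rule R.add.subgroupI)
      fix a assume a: "a \<in> I"
      have "\<ominus>\<^bsub>?R\<^esub> a = - a"
        by (rule R.minus_equality) (auto simp: ring_of_type_algebra_def)
      with a show "\<ominus>\<^bsub>?R\<^esub> a \<in> I" by (simp add: I_def)
    qed (auto simp: ring_of_type_algebra_def I_def)
  qed (auto simp: ring_of_type_algebra_def I_def)
  moreover have "c \<in> I" "1 \<notin> I" using False by (simp_all add: I_def)
  then have "I \<noteq> {0}" "I \<noteq> UNIV" using assms(2) by blast+
  ultimately have fin: "finite (carrier (?R Quot I))"
    using assms(1) by (auto simp: finite_residue_rings_def)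
  \<comment> \<open>One representative is chosen from each coset of the ideal of multiples of
    \<open>c\<close>.\<close>
  define T where "T = (\<lambda>C. SOME y. y \<in> C) ` carrier (?R Quot I)"
  have "\<exists>y\<in>T. c dvd x - y" for x
  proof -
    define C where "C = {i + x | i. i \<in> I}"
    have "C \<in> carrier (?R Quot I)"
      by (auto simp: C_def FactRing_def A_RCOSETS_def RCOSETS_def r_coset_def ring_of_type_algebra_def)
    moreover have "x \<in> C" by (auto simp: C_def I_def)
    then have "(SOME y. y \<in> C) \<in> C" by (rule someI)
    then have "c dvd x - (SOME y. y \<in> C)" by (auto simp: C_def I_def dvd_diff_commute)
    ultimately show ?thesis by (auto simp: T_def)
  qed
  then show thesis using fin by (intro that[of T]) (auto simp: T_def)
qed

text \<open>Reducing the lower coefficients modulo \<open>c\<close> leaves finitely many monic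
  representatives. Their product will be the core of the polynomial \<open>\<phi>\<close> that works
  for all \<open>a\<close> at once.\<close>

lemma finite_monic_residues:
  fixes c :: "'d::idom"
  assumes "finite_residue_rings TYPE('d)" and "c \<noteq> 0"
  obtains S where "finite S" "\<And>s. s \<in> S \<Longrightarrow> lead_coeff s = 1"
    "\<And>m. lead_coeff m = 1 \<Longrightarrow> degree m = n \<Longrightarrow> \<exists>s\<in>S. \<exists>r. s = m + smult c r"
proof -
  obtain T where T: "finite T" "\<And>x. \<exists>y\<in>T. c dvd x - y"
    by (rule finite_residues[OF assms]) blast
  \<comment> \<open>The value 1 is inserted because the leading coefficient stays 1 instead of being
    replaced by its representative in \<open>T\<close>.\<close>
  define S where "S = {s. lead_coeff s = 1 \<and> degree s = n \<and> set (coeffs s) \<subseteq> insert 1 T}"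
  have "S \<subseteq> Poly ` {xs. set xs \<subseteq> insert 1 T \<and> length xs \<le> Suc n}"
  proof
    fix s assume "s \<in> S"
    then show "s \<in> Poly ` {xs. set xs \<subseteq> insert 1 T \<and> length xs \<le> Suc n}"
      using length_coeffs_degree[of s]
      by (intro image_eqI[of _ _ "coeffs s"]) (cases "s = 0"; auto simp: S_def)+
  qed
  moreover have "finite (Poly ` {xs. set xs \<subseteq> insert 1 T \<and> length xs \<le> Suc n})"
    using T(1) by (intro finite_imageI finite_lists_length_le) auto
  ultimately have "finite S" by (rule finite_subset)
  moreover have "\<exists>s\<in>S. \<exists>r. s = m + smult c r" if m: "lead_coeff m = 1" "degree m = n" for m
  proof -
    have "\<exists>u. x + c * u \<in> T" for x
    proof -
      obtain y where "y \<in> T" "c dvd x - y" using T(2) by blast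
      then obtain u where "x - y = c * u" by (auto elim: dvdE)
      then have "y = x + c * (- u)" by (simp add: algebra_simps)
      with \<open>y \<in> T\<close> show ?thesis by blast
    qed
    then obtain u where u: "\<And>x. x + c * u x \<in> T" by metis
    define r where "r = (\<Sum>i<n. monom (u (coeff m i)) i)"
    define s where "s = m + smult c r"
    have r: "coeff r i = (if i < n then u (coeff m i) else 0)" for i
      by (simp add: r_def coeff_sum)
    have s: "coeff s i = (if i < n then coeff m i + c * u (coeff m i) else coeff m i)" for i
      by (simp add: s_def r)
    have "coeff s n = 1" using m by (simp add: s)
    moreover have "degree s \<le> n" by (rule degree_le) (use m in \<open>auto simp: s coeff_eq_0\<close>)
    ultimately have deg: "degree s = n" by (metis le_antisym le_degree zero_neq_one)
    have "coeff s i \<in> insert 1 T" if "i \<le> n" for i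
      using that u m by (cases "i = n") (auto simp: s)
    then have "coeff s ` {..n} \<subseteq> insert 1 T" by blast
    moreover have "set (coeffs s) \<subseteq> coeff s ` {..n}" using deg by (auto simp: coeffs_def)
    ultimately have "set (coeffs s) \<subseteq> insert 1 T" by (rule order.trans[rotated])
    then have "s \<in> S" using \<open>coeff s n = 1\<close> deg by (simp add: S_def)
    then show ?thesis by (auto simp: s_def)
  qed
  ultimately show thesis by (intro that[of S]) (auto simp: S_def)
qed

text \<open>An element integral over \<open>R\<close> is integral over the whole ring
  \<open>'e\<close>, hence lies in it. Injectivity of \<open>to_fract\<close> then moves the monic
  equation back from the quotient field.\<close>

lemma integral_closure_elim:
  assumes "integrally_closed TYPE('e::idom)" and "z \<in> integral_closure R"
  obtains f p where "z = to_fract (f :: 'e)" "lead_coeff p = 1" "\<And>i. coeff p i \<in> R" "poly p f = 0"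
proof -
  interpret comm_hom "to_fract :: 'e \<Rightarrow> 'e fract"
    by unfold_locales (auto simp: mult.commute)
  from assms(2) obtain P where P: "lead_coeff P = 1" "\<And>i. coeff P i \<in> to_fract ` R" "poly P z = 0"
    and z: "z \<in> quotient_field_of R"
    by (auto simp: integral_closure_def integral_over_def)
  have "z \<in> quotient_field_of UNIV" using z unfolding quotient_field_of_def by blast
  moreover have "integral_over (range to_fract) z"
    unfolding integral_over_def using P by blast
  ultimately have "z \<in> integral_closure UNIV" by (simp add: integral_closure_def)
  then obtain f where f: "z = to_fract f"
    using assms(1) by (auto simp: integrally_closed_def)
  define v where "v = the_inv (to_fract :: 'e \<Rightarrow> _)"
  define p where "p = map_poly v P"
  have v: "v (to_fract x) = x" for x
    unfolding v_def by (rule the_inv_f_f) (auto intro: injI)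
  have "v 0 = 0" using v[of 0] by simp
  then have c: "to_fract (coeff p i) = coeff P i \<and> coeff p i \<in> R" for i
    using P(2)[of i] v by (auto simp: p_def coeff_map_poly)
  then have map: "map_poly to_fract p = P" by (intro poly_eqI) (simp add: coeff_map_poly)
  then have "degree p = degree P" by (metis degree_map_poly to_fract_eq_0_iff)
  then have "lead_coeff p = 1" using c[of "degree p"] P(1) by (simp flip: to_fract_1)
  moreover have "to_fract (poly p f) = poly (map_poly to_fract p) (to_fract f)"
    by (induction p) (auto simp: map_poly_pCons)
  then have "poly p f = 0" using P(3) by (simp add: map f)
  ultimately show thesis using that f c by blast
qed

section \<open>Values at the roots of minimal polynomials\<close>

abbreviation integral_over_D :: "'d::idom fract alg_closure \<Rightarrow> bool" where
  "integral_over_D \<equiv> central_hom.integral (\<lambda>d. to_ac (to_fract d))"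

lemma comm_hom_to_ac: "comm_hom to_ac"
  by unfold_locales (auto simp: mult.commute)

lemma comm_hom_to_ac_to_fract: "comm_hom (\<lambda>d. to_ac (to_fract d))"
  by unfold_locales (auto simp: mult.commute)

lemma map_poly_to_ac_to_fract:
  "map_poly to_ac (map_poly to_fract p) = map_poly (\<lambda>d. to_ac (to_fract d)) p"
  by (simp add: map_poly_map_poly o_def)

lemma integral_over_D_iff:
  "integral_over_D \<alpha> \<longleftrightarrow>
    (\<exists>p. lead_coeff p = 1 \<and> poly (map_poly (\<lambda>d. to_ac (to_fract d)) p) \<alpha> = 0)"
proof -
  interpret comm_hom "\<lambda>d. to_ac (to_fract d)" by (rule comm_hom_to_ac_to_fract)
  show ?thesis by (simp add: integral_def aeval_eq_poly)
qed

lemma integral_over_D_if_Lambda: "\<alpha> \<in> Lambda n \<Longrightarrow> integral_over_D \<alpha>"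
  by (auto simp: Lambda_def integral_over_D_iff)

lemma poly_pcompose_to_ac:
  "poly (map_poly to_ac (pcompose g f)) \<alpha> = poly (map_poly to_ac g) (poly (map_poly to_ac f) \<alpha>)"
proof -
  interpret comm_hom to_ac by (rule comm_hom_to_ac)
  show ?thesis using aeval_pcompose[of g f \<alpha>] by (simp only: aeval_eq_poly)
qed

lemma integral_over_D_to_ac:
  fixes c :: "'d::idom fract"
  assumes "integrally_closed TYPE('d)" and "integral_over_D (to_ac c)"
  shows "c \<in> range to_fract"
proof -
  obtain p :: "'d poly" where p: "lead_coeff p = 1" "poly (map_poly to_ac (map_poly to_fract p)) (to_ac c) = 0"
    using assms(2) by (auto simp: integral_over_D_iff map_poly_to_ac_to_fract)
  have "poly (map_poly to_ac g) (to_ac c) = to_ac (poly g c)" for g :: "'d fract poly"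
    by (induction g) (auto simp: map_poly_pCons)
  with p(2) have "poly (map_poly to_fract p) c = 0" by simp
  moreover have "lead_coeff (map_poly to_fract p) = 1"
    using p(1) by (subst lead_coeff_map_poly_nz) auto
  ultimately have "integral_over (range to_fract) c"
    unfolding integral_over_def by (intro exI[of _ "map_poly to_fract p"]) (simp add: coeff_map_poly)
  moreover have "c \<in> quotient_field_of UNIV"
    unfolding quotient_field_of_def by (cases c) auto
  ultimately have "c \<in> integral_closure UNIV" by (simp add: integral_closure_def)
  with assms(1) show ?thesis by (simp add: integrally_closed_def)
qed

text \<open>Roots of \<open>m\<close> are roots of \<open>p\<close>, so the coefficients of
  \<open>m\<close> are integral over \<open>D\<close>; they lie in \<open>K\<close>, hence in
  \<open>D\<close>.\<close>

lemma monic_factor_integral_coeffs: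
  fixes m :: "'d::idom fract poly"
  assumes "integrally_closed TYPE('d)" and "lead_coeff m = 1"
    and "lead_coeff p = 1" and "m dvd map_poly to_fract p"
  obtains q where "m = map_poly to_fract q" "lead_coeff q = 1"
proof -
  have "integral_over_D \<alpha>" if "poly (map_poly to_ac m) \<alpha> = 0" for \<alpha>
  proof -
    obtain r where "map_poly to_fract p = m * r" using assms(4) by (rule dvdE)
    then have "poly (map_poly to_ac (map_poly to_fract p)) \<alpha> = 0"
      using that by (simp add: map_poly_to_ac_mult)
    with assms(3) show ?thesis by (auto simp: integral_over_D_iff map_poly_to_ac_to_fract)
  qed
  moreover have "lead_coeff (map_poly to_ac m) = 1"
    using assms(2) by (subst lead_coeff_map_poly_nz) auto
  ultimately have "integral_over_D (coeff (map_poly to_ac m) i)" for i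
    by (intro integral_coeff_of_integral_roots[OF comm_hom_to_ac_to_fract])
  then have c: "coeff m i \<in> range to_fract" for i
    by (intro integral_over_D_to_ac[OF assms(1)]) (simp add: coeff_map_poly)
  define v where "v = the_inv (to_fract :: 'd \<Rightarrow> _)"
  define q where "q = map_poly v m"
  have v: "v (to_fract x) = x" for x
    unfolding v_def by (rule the_inv_f_f) (auto intro: injI)
  have "v 0 = 0" using v[of 0] by simp
  then have "to_fract (coeff q i) = coeff m i" for i
    using c[of i] v by (auto simp: q_def coeff_map_poly)
  then have m: "m = map_poly to_fract q" by (intro poly_eqI) (simp add: coeff_map_poly)
  moreover have "q \<noteq> 0" using m assms(2) by auto
  then have "to_fract (lead_coeff q) = lead_coeff m"
    unfolding m by (subst lead_coeff_map_poly_nz) auto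
  then have "to_fract (lead_coeff q) = to_fract 1" using assms(2) by simp
  then have "lead_coeff q = 1" by (simp only: to_fract_eq_iff)
  ultimately show thesis by (rule that)
qed

section \<open>Values of polynomials on \<open>A\<close> and on \<open>Omega_A\<close>\<close>

context base_change
begin

text \<open>Two monic generators of the same ideal divide each other and so agree, which justifies
  the \<open>THE\<close> in \<open>min_poly\<close>.\<close>

lemma min_poly_monic: "lead_coeff (min_poly t b) = 1"
  and aeval_eq_0_iff: "KB.aeval f b = 0 \<longleftrightarrow> min_poly t b dvd f"
proof -
  obtain p where "p \<noteq> 0" "KB.aeval p b = 0" using annihilator_degree_le_dim by blast
  then obtain q where q: "lead_coeff q = 1" "{f. KB.aeval f b = 0} = {f. q dvd f}"
    using zero_set_principal[OF KB.central_hom_axioms] by blast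
  then have iff: "KB.aeval f b = 0 \<longleftrightarrow> q dvd f" for f by (simp add: set_eq_iff)
  have "min_poly t b = q"
    unfolding min_poly_def eval_B_eq
  proof (rule the_equality)
    fix q' assume q': "lead_coeff q' = 1 \<and> {f. KB.aeval f b = 0} = {f. q' dvd f}"
    then have eq: "q dvd f \<longleftrightarrow> q' dvd f" for f by (simp add: iff set_eq_iff)
    have "q dvd q'" "q' dvd q" using eq[of q'] eq[of q] by simp_all
    with q(1) q' show "q' = q" by (intro monic_dvd_antisym) simp_all
  qed (use q in simp)
  with q(1) iff show "lead_coeff (min_poly t b) = 1" "KB.aeval f b = 0 \<longleftrightarrow> min_poly t b dvd f"
    by simp_all
qed

lemma A'_iff: "b \<in> A' t \<longleftrightarrow> (\<exists>p. lead_coeff p = 1 \<and> KB.aeval (map_poly to_fract p) b = 0)"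
  by (simp add: A'_def eval_B_eq)

lemma monic_annihilator_of_degree_dim:
  assumes "integrally_closed TYPE('d)" and "b \<in> A' t"
  obtains m :: "'d poly" where "lead_coeff m = 1" "degree m = dim_B t"
    "KB.aeval (map_poly to_fract m) b = 0"
proof -
  obtain p where p: "lead_coeff p = 1" "KB.aeval (map_poly to_fract p) b = 0"
    using assms(2) by (auto simp: A'_iff)
  then obtain q where q: "min_poly t b = map_poly to_fract q" "lead_coeff q = 1"
    using monic_factor_integral_coeffs[OF assms(1) min_poly_monic p(1)] by (auto simp: aeval_eq_0_iff)
  obtain r where "r \<noteq> 0" "degree r \<le> dim_B t" "KB.aeval r b = 0"
    using annihilator_degree_le_dim by blast
  then have "degree (min_poly t b) \<le> dim_B t"
    using dvd_imp_degree_le[of "min_poly t b" r] by (simp add: aeval_eq_0_iff)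
  then have le: "degree q \<le> dim_B t" by (simp add: q degree_map_poly)
  \<comment> \<open>\<open>Lambda\<close> asks for degree exactly \<open>n\<close>, hence the
    padding by a power of \<open>X\<close>.\<close>
  define m where "m = q * monom 1 (dim_B t - degree q)"
  have "q \<noteq> 0" using q by auto
  then have "degree m = degree q + degree (monom (1 :: 'd) (dim_B t - degree q))"
    unfolding m_def by (intro degree_mult_eq) (auto simp: monom_eq_0_iff)
  also have "degree (monom (1 :: 'd) (dim_B t - degree q)) = dim_B t - degree q"
    by (rule degree_monom_eq) simp
  finally have "degree m = dim_B t" using le by simp
  moreover have "lead_coeff m = 1" unfolding m_def lead_coeff_mult by (simp only: lead_coeff_monom q(2) mult_1)
  moreover have "KB.aeval (map_poly to_fract m) b = 0"
    by (simp add: aeval_eq_0_iff m_def flip: q(1))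
  ultimately show thesis by (intro that)
qed

lemma Omega_root:
  assumes "\<alpha> \<in> Omega t b" and "KB.aeval g b = 0"
  shows "poly (map_poly to_ac g) \<alpha> = 0"
proof -
  obtain r where "g = min_poly t b * r" using assms(2) by (auto simp: aeval_eq_0_iff elim: dvdE)
  with assms(1) show ?thesis by (simp add: map_poly_to_ac_mult Omega_def)
qed

lemma Int_B_imp_Lambda:
  assumes "integrally_closed TYPE('d)" and "f \<in> Int_B t (A_in_B t) (A' t)" and "\<alpha> \<in> Omega_A t"
  shows "poly (map_poly to_ac f) \<alpha> \<in> Lambda (dim_B t)"
proof -
  from assms(3) obtain a where a: "a \<in> A_in_B t" "\<alpha> \<in> Omega t a" by (auto simp: Omega_A_def)
  then have "KB.aeval f a \<in> A' t" using assms(2) by (auto simp: Int_B_def eval_B_eq)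
  then obtain m :: "'d poly" where m: "lead_coeff m = 1" "degree m = dim_B t"
    "KB.aeval (map_poly to_fract m) (KB.aeval f a) = 0"
    by (rule monic_annihilator_of_degree_dim[OF assms(1)])
  then have "KB.aeval (pcompose (map_poly to_fract m) f) a = 0" by (simp add: KB.aeval_pcompose)
  from Omega_root[OF a(2) this]
  have "poly (map_poly (\<lambda>d. to_ac (to_fract d)) m) (poly (map_poly to_ac f) \<alpha>) = 0"
    by (simp add: poly_pcompose_to_ac map_poly_to_ac_to_fract)
  with m(1,2) show ?thesis unfolding Lambda_def by blast
qed

lemma Int_B_if_integral_on_Omega_A:
  assumes "\<And>\<alpha>. \<alpha> \<in> Omega_A t \<Longrightarrow> integral_over_D (poly (map_poly to_ac f) \<alpha>)"
  shows "f \<in> Int_B t (A_in_B t) (A' t)"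
  unfolding Int_B_def eval_B_eq
proof (intro CollectI ballI)
  fix a assume a: "a \<in> A_in_B t"
  let ?\<mu> = "min_poly t a"
  have nz: "?\<mu> \<noteq> 0" using min_poly_monic[of a] by auto
  then have fin: "finite (Omega t a)"
    unfolding Omega_def by (intro poly_roots_finite) (simp add: map_poly_eq_0_iff)
  have "\<forall>\<alpha>\<in>Omega t a. \<exists>p :: 'd poly. lead_coeff p = 1 \<and>
      poly (map_poly (\<lambda>d. to_ac (to_fract d)) p) (poly (map_poly to_ac f) \<alpha>) = 0"
    using assms a by (auto simp: Omega_A_def simp flip: integral_over_D_iff)
  then obtain P :: "'d fract alg_closure \<Rightarrow> 'd poly" where P: "\<And>\<alpha>. \<alpha> \<in> Omega t a \<Longrightarrow> lead_coeff (P \<alpha>) = 1 \<and>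
      poly (map_poly (\<lambda>d. to_ac (to_fract d)) (P \<alpha>)) (poly (map_poly to_ac f) \<alpha>) = 0"
    by metis
  \<comment> \<open>One monic polynomial handles all the finitely many roots of
    \<open>min_poly t a\<close> together.\<close>
  define p where "p = (\<Prod>\<alpha>\<in>Omega t a. P \<alpha>)"
  have lc: "lead_coeff p = 1" using P by (simp add: p_def lead_coeff_prod)
  have "poly (map_poly to_ac (pcompose (map_poly to_fract p) f)) \<alpha> = 0"
    if "poly (map_poly to_ac ?\<mu>) \<alpha> = 0" for \<alpha>
  proof -
    have \<alpha>: "\<alpha> \<in> Omega t a" using that by (simp add: Omega_def)
    then have "p = P \<alpha> * (\<Prod>\<beta>\<in>Omega t a - {\<alpha>}. P \<beta>)"
      unfolding p_def by (rule prod.remove[OF fin])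
    then show ?thesis
      using P[OF \<alpha>]
      by (simp add: poly_pcompose_to_ac map_poly_to_ac_mult map_poly_to_ac_to_fract)
  qed
  \<comment> \<open>The minimal polynomial may have repeated roots, so it is only known to divide a
    power of the composite.\<close>
  from dvd_power_if_alg_closure_roots[OF nz this]
  have "KB.aeval (pcompose (map_poly to_fract p) f ^ degree ?\<mu>) a = 0"
    by (simp add: aeval_eq_0_iff)
  moreover have "map_poly to_fract (p ^ k) = map_poly to_fract p ^ k" for k
    by (induction k) auto
  ultimately have "KB.aeval (map_poly to_fract (p ^ degree ?\<mu>)) (KB.aeval f a) = 0"
    by (simp add: KB.aeval_power KB.aeval_pcompose)
  moreover have "lead_coeff (p ^ degree ?\<mu>) = 1" by (simp only: lead_coeff_power lc power_one)
  ultimately show "KB.aeval f a \<in> A' t" by (auto simp: A'_iff)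
qed

lemma Int_B_iff_integral_on_Omega_A:
  assumes "integrally_closed TYPE('d)"
  shows "f \<in> Int_B t (A_in_B t) (A' t) \<longleftrightarrow>
    (\<forall>\<alpha>\<in>Omega_A t. integral_over_D (poly (map_poly to_ac f) \<alpha>))"
  using Int_B_imp_Lambda[OF assms] integral_over_D_if_Lambda Int_B_if_integral_on_Omega_A by blast

lemma Int_B_eq_Int_K:
  assumes "integrally_closed TYPE('d)"
  shows "Int_B t (A_in_B t) (A' t) = Int_K (Omega_A t) (Lambda (dim_B t))"
proof (intro equalityI subsetI)
  fix f assume "f \<in> Int_B t (A_in_B t) (A' t)"
  with Int_B_imp_Lambda[OF assms] show "f \<in> Int_K (Omega_A t) (Lambda (dim_B t))"
    by (simp add: Int_K_def)
next
  fix f assume "f \<in> Int_K (Omega_A t) (Lambda (dim_B t))"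
  then show "f \<in> Int_B t (A_in_B t) (A' t)"
    by (intro Int_B_if_integral_on_Omega_A integral_over_D_if_Lambda[of _ "dim_B t"])
      (simp add: Int_K_def)
qed

text \<open>Sums of noncommuting integral elements of \<open>B\<close> need not be integral. The
  criterion on \<open>Omega_A\<close> moves the question into the commutative algebraic
  closure.\<close>

lemma subring_Int_B:
  assumes "integrally_closed TYPE('d)"
  shows "subring (Int_B t (A_in_B t) (A' t)) ring_of_type_algebra"
proof -
  let ?R = "ring_of_type_algebra :: 'd fract poly ring" and ?I = "Int_B t (A_in_B t) (A' t)"
  interpret R: ring ?R by (rule ring_from_type_algebra)
  interpret D: comm_hom "\<lambda>d :: 'd. to_ac (to_fract d)" by (rule comm_hom_to_ac_to_fract)
  interpret ac: comm_hom "to_ac :: 'd fract \<Rightarrow> _" by (rule comm_hom_to_ac)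
  note iff = Int_B_iff_integral_on_Omega_A[OF assms]
  have neg: "poly (map_poly to_ac (- p)) \<alpha> = - poly (map_poly to_ac p) \<alpha>" for p :: "'d fract poly" and \<alpha>
    using ac.aeval_uminus[of p \<alpha>] by (simp only: ac.aeval_eq_poly)
  show ?thesis
  proof (rule R.subringI)
    fix p assume p: "p \<in> ?I"
    have "\<ominus>\<^bsub>?R\<^esub> p = - p" by (rule R.minus_equality) (auto simp: ring_of_type_algebra_def)
    with p show "\<ominus>\<^bsub>?R\<^esub> p \<in> ?I" by (auto simp: iff neg intro: D.integral_uminus)
  qed (auto simp: ring_of_type_algebra_def iff map_poly_to_ac_mult map_poly_to_ac_add
      intro: D.integral_1 D.integral_add D.integral_mult)
qed

text \<open>Such an element is a polynomial \<open>f\<close> because \<open>K[X]\<close> is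
  integrally closed. Evaluating its monic equation at \<open>\<alpha>\<close> in
  \<open>Omega_A t\<close> gives integral coefficients, and transitivity makes
  \<open>f(\<alpha>)\<close> integral.\<close>

lemma integral_closure_subset_Int_B:
  assumes "integrally_closed TYPE('d)" and "R \<subseteq> Int_B t (A_in_B t) (A' t)"
  shows "integral_closure R \<subseteq> to_fract ` Int_B t (A_in_B t) (A' t)"
proof
  interpret D: comm_hom "\<lambda>d :: 'd. to_ac (to_fract d)" by (rule comm_hom_to_ac_to_fract)
  fix z assume "z \<in> integral_closure R"
  then obtain f p where f: "z = to_fract f" and p: "lead_coeff p = 1" "\<And>i. coeff p i \<in> R" "poly p f = 0"
    by (rule integral_closure_elim[OF integrally_closed_euclidean_ring]) blast
  have "integral_over_D (poly (map_poly to_ac f) \<alpha>)" if \<alpha>: "\<alpha> \<in> Omega_A t" for \<alpha>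
  proof -
    define ev where "ev r = poly (map_poly to_ac r) \<alpha>" for r :: "'d fract poly"
    interpret ev: comm_hom ev
      by unfold_locales (auto simp: ev_def map_poly_to_ac_mult map_poly_to_ac_add mult.commute)
    have "ev (poly p f) = poly (map_poly ev p) (ev f)"
      by (induction p) (auto simp: map_poly_pCons ev.hom_zero ev.hom_add ev.hom_mult)
    then have "poly (map_poly ev p) (ev f) = 0" using p(3) by (simp add: ev.hom_zero)
    moreover have "lead_coeff (map_poly ev p) = 1"
      using p(1) by (subst lead_coeff_map_poly_nz) (auto simp: ev.hom_zero ev.hom_one)
    moreover have "integral_over_D (coeff (map_poly ev p) i)" for i
      using p(2)[of i] assms(2) \<alpha>
      by (auto simp: coeff_map_poly ev.hom_zero ev_def Int_B_iff_integral_on_Omega_A[OF assms(1)])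
    ultimately have "integral_over_D (ev f)" using D.integral_trans[of "map_poly ev p" "ev f"] by simp
    then show ?thesis by (simp add: ev_def)
  qed
  then show "z \<in> to_fract ` Int_B t (A_in_B t) (A' t)"
    unfolding f by (intro imageI Int_B_if_integral_on_Omega_A)
qed

section \<open>The rings \<open>D[X] + mu_a K[X]\<close>\<close>

lemma pullback_ring_iff: "f \<in> pullback_ring t a \<longleftrightarrow> (\<exists>g. min_poly t a dvd f - map_poly to_fract g)"
proof
  assume "f \<in> pullback_ring t a"
  then obtain g h where "f = map_poly to_fract g + min_poly t a * h" by (auto simp: pullback_ring_def)
  then show "\<exists>g. min_poly t a dvd f - map_poly to_fract g" by (intro exI[of _ g]) simp
next
  assume "\<exists>g. min_poly t a dvd f - map_poly to_fract g"
  then obtain g h where "f - map_poly to_fract g = min_poly t a * h" by (auto elim: dvdE)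
  then have "f = map_poly to_fract g + min_poly t a * h" by (simp add: algebra_simps)
  then show "f \<in> pullback_ring t a" by (auto simp: pullback_ring_def)
qed

lemma pullback_ring_diff:
  assumes "f \<in> pullback_ring t a" "g \<in> pullback_ring t a"
  shows "f - g \<in> pullback_ring t a"
proof -
  obtain u v where "min_poly t a dvd f - map_poly to_fract u" "min_poly t a dvd g - map_poly to_fract v"
    using assms by (auto simp: pullback_ring_iff)
  then have "min_poly t a dvd (f - map_poly to_fract u) - (g - map_poly to_fract v)" by (rule dvd_diff)
  then have "min_poly t a dvd (f - g) - map_poly to_fract (u - v)" by (simp add: algebra_simps)
  then show ?thesis unfolding pullback_ring_iff by blast
qed

lemma map_poly_to_fract_in_pullback_ring: "map_poly to_fract g \<in> pullback_ring t a"
  unfolding pullback_ring_iff by (intro exI[of _ g]) simp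

text \<open>Modulo \<open>min_poly t a\<close> the polynomial agrees with some \<open>g\<close> in
  \<open>D[X]\<close>, and \<open>g(a)\<close> stays in \<open>A\<close>.\<close>

lemma pullback_rings_subset_Int_B:
  "(\<Inter>a \<in> A_in_B t. pullback_ring t a) \<subseteq> Int_B t (A_in_B t) (A_in_B t)"
  unfolding Int_B_def eval_B_eq
proof (intro subsetI CollectI ballI)
  fix f a assume f: "f \<in> (\<Inter>a \<in> A_in_B t. pullback_ring t a)" and a: "a \<in> A_in_B t"
  then obtain g where "min_poly t a dvd f - map_poly to_fract g" by (auto simp: pullback_ring_iff)
  then have "KB.aeval f a = KB.aeval (map_poly to_fract g) a"
    by (simp add: KB.aeval_diff flip: aeval_eq_0_iff)
  with eval_in_A[OF a] show "KB.aeval f a \<in> A_in_B t" by simp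
qed

end

section \<open>Integrality over the pullback rings\<close>

context base_change
begin

text \<open>Every monic polynomial of degree \<open>n\<close> over \<open>D\<close> is congruent to a factor of \<open>\<phi>\<close> modulo
  \<open>d ^ n\<close>. So if \<open>m\<close> annihilates \<open>f(a)\<close>, then \<open>\<phi>\<close> is \<open>d ^ n\<close> times a polynomial of degree less than \<open>n\<close>
  modulo \<open>m\<close>, and \<open>d ^ n\<close> clears the denominators of its value at \<open>f\<close>.\<close>

lemma monic_composition_in_pullback_rings:
  assumes "integrally_closed TYPE('d)" and "finite_residue_rings TYPE('d)"
    and "f \<in> Int_B t (A_in_B t) (A' t)"
  obtains \<phi> :: "'d poly" where "lead_coeff \<phi> = 1" "degree \<phi> > 0"
    "\<And>a. a \<in> A_in_B t \<Longrightarrow> pcompose (map_poly to_fract \<phi>) f \<in> pullback_ring t a"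
proof -
  let ?n = "dim_B t"
  obtain d g where d: "d \<noteq> 0" "smult (to_fract d) f = map_poly to_fract g"
    by (rule clear_denominators)
  define c where "c = d ^ ?n"
  have c0: "c \<noteq> 0" and c: "to_fract c = to_fract d ^ ?n"
    using d(1) to_fract_power[of d ?n] by (simp_all add: c_def)
  obtain S where S: "finite S" "\<And>s. s \<in> S \<Longrightarrow> lead_coeff s = 1"
    and res: "\<And>m. lead_coeff m = 1 \<Longrightarrow> degree m = ?n \<Longrightarrow> \<exists>s\<in>S. \<exists>r. s = m + smult c r"
    by (rule finite_monic_residues[OF assms(2) c0, of ?n]) blast
  \<comment> \<open>The extra factor \<open>X\<close> makes the degree positive whatever
    \<open>S\<close> is.\<close>
  define \<phi> where "\<phi> = [:0, 1:] * (\<Prod>s\<in>S. s)"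
  have lc: "lead_coeff (\<Prod>s\<in>S. s) = 1" using S(2) by (simp add: lead_coeff_prod)
  then have nz: "(\<Prod>s\<in>S. s) \<noteq> 0" by auto
  have "lead_coeff \<phi> = 1" unfolding \<phi>_def lead_coeff_mult lc by simp
  moreover have "degree \<phi> > 0" unfolding \<phi>_def using nz by (subst degree_mult_eq) auto
  moreover have "pcompose (map_poly to_fract \<phi>) f \<in> pullback_ring t a" if a: "a \<in> A_in_B t" for a
  proof -
    have "KB.aeval f a \<in> A' t" using a assms(3) by (auto simp: Int_B_def eval_B_eq)
    then obtain m :: "'d poly" where m: "lead_coeff m = 1" "degree m = ?n"
      "KB.aeval (map_poly to_fract m) (KB.aeval f a) = 0"
      by (rule monic_annihilator_of_degree_dim[OF assms(1)])
    obtain s r where s: "s \<in> S" "s = m + smult c r" using res[OF m(1,2)] by blast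
    define \<psi> where "\<psi> = [:0, 1:] * (\<Prod>s\<in>S - {s}. s)"
    have \<phi>: "\<phi> = s * \<psi>"
      unfolding \<phi>_def \<psi>_def by (subst prod.remove[OF S(1) s(1)]) (simp add: mult.left_commute)
    obtain q v where v: "r * \<psi> = m * q + v" "v = 0 \<or> degree v < degree m"
      by (rule monic_division[OF m(1)])
    have "degree v \<le> ?n" using v(2) m(2) by auto
    then obtain u where u: "smult (to_fract c) (pcompose (map_poly to_fract v) f) = map_poly to_fract u"
      using clear_denominators_pcompose[OF d(2)] unfolding c by blast
    have "\<phi> = m * (\<psi> + smult c q) + smult c v"
    proof -
      have "\<phi> = m * \<psi> + smult c (r * \<psi>)" by (simp add: \<phi> s(2) distrib_right)
      then show ?thesis by (simp add: v(1) smult_add_right distrib_left)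
    qed
    then have "pcompose (map_poly to_fract \<phi>) f - map_poly to_fract u =
        pcompose (map_poly to_fract m) f * pcompose (map_poly to_fract (\<psi> + smult c q)) f"
      unfolding u[symmetric] by (simp only: fract_poly_add fract_poly_mult fract_poly_smult
        pcompose_add pcompose_mult pcompose_smult add_diff_cancel)
    moreover have "min_poly t a dvd pcompose (map_poly to_fract m) f"
      using m(3) by (simp add: KB.aeval_pcompose flip: aeval_eq_0_iff)
    ultimately show ?thesis unfolding pullback_ring_iff by (metis dvd_mult2)
  qed
  ultimately show thesis by (rule that)
qed

text \<open>The monic polynomial \<open>\<phi>(X) - \<phi>(f)\<close> has \<open>f\<close> as a
  root. Its coefficients are constants from \<open>D\<close>, except that the constant term also
  involves \<open>\<phi>(f)\<close>, which lies in every pullback ring.\<close>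

lemma Int_B_subset_integral_closure:
  assumes "integrally_closed TYPE('d)" and "finite_residue_rings TYPE('d)"
  shows "to_fract ` Int_B t (A_in_B t) (A' t) \<subseteq> integral_closure (\<Inter>a \<in> A_in_B t. pullback_ring t a)"
proof
  let ?R = "\<Inter>a \<in> A_in_B t. pullback_ring t a"
  fix z assume "z \<in> to_fract ` Int_B t (A_in_B t) (A' t)"
  then obtain f where f: "z = to_fract f" "f \<in> Int_B t (A_in_B t) (A' t)" by auto
  obtain d g where d: "d \<noteq> 0" "smult (to_fract d) f = map_poly to_fract g"
    by (rule clear_denominators)
  have const: "[:to_fract c:] \<in> ?R" for c
    using map_poly_to_fract_in_pullback_ring[of "[:c:]"] by (simp add: map_poly_pCons)
  \<comment> \<open>A common denominator \<open>d\<close> writes \<open>f\<close> as the quotient of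
    \<open>d f\<close> in \<open>D[X]\<close> by the constant \<open>d\<close>, both members of
    \<open>?R\<close>.\<close>
  have "z = Fract (map_poly to_fract g) [:to_fract d:]"
    unfolding f(1) d(2)[symmetric] to_fract_def[of f] using d(1) by (simp add: eq_fract)
  moreover have "map_poly to_fract g \<in> ?R" by (intro INT_I map_poly_to_fract_in_pullback_ring)
  moreover have "[:to_fract d:] \<noteq> 0" using d(1) by simp
  ultimately have quot: "z \<in> quotient_field_of ?R"
    unfolding quotient_field_of_def using const[of d] by blast
  obtain \<phi> :: "'d poly" where \<phi>: "lead_coeff \<phi> = 1" "degree \<phi> > 0"
    "\<And>a. a \<in> A_in_B t \<Longrightarrow> pcompose (map_poly to_fract \<phi>) f \<in> pullback_ring t a"
    by (rule monic_composition_in_pullback_rings[OF assms f(2)]) blast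
  define \<Phi> where "\<Phi> = map_poly (\<lambda>c. [:to_fract c:]) \<phi>"
  define P where "P = \<Phi> - [:poly \<Phi> f:]"
  have val: "poly \<Phi> f = pcompose (map_poly to_fract \<phi>) f"
    by (simp add: \<Phi>_def pcompose_altdef map_poly_map_poly o_def)
  have coeff: "coeff P i = [:to_fract (coeff \<phi> i):] - (if i = 0 then poly \<Phi> f else 0)" for i
    by (auto simp: P_def \<Phi>_def coeff_map_poly coeff_pCons split: nat.splits)
  have "poly \<Phi> f \<in> ?R" using \<phi>(3) by (simp add: val)
  then have "coeff P i \<in> ?R" for i
    using const[of "coeff \<phi> i"] by (auto simp: coeff intro: pullback_ring_diff)
  moreover have "lead_coeff P = 1"
  proof -
    \<comment> \<open>Positive degree keeps the subtracted constant away from the leading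
      coefficient.\<close>
    have "coeff P (degree \<phi>) = 1" using \<phi> by (simp add: coeff one_pCons)
    moreover have "degree P \<le> degree \<phi>"
      by (rule degree_le) (use \<phi>(2) in \<open>auto simp: coeff coeff_eq_0\<close>)
    ultimately show ?thesis by (metis le_antisym le_degree zero_neq_one)
  qed
  moreover have "poly P f = 0" by (simp add: P_def)
  moreover have "to_fract (poly P f) = poly (map_poly to_fract P) z"
    by (induction P) (auto simp: map_poly_pCons f(1))
  moreover have "lead_coeff (map_poly to_fract P) = to_fract (lead_coeff P)"
    using \<open>lead_coeff P = 1\<close> by (intro lead_coeff_map_poly_nz) auto
  ultimately have "integral_over (to_fract ` ?R) z"
    unfolding integral_over_def by (intro exI[of _ "map_poly to_fract P"]) (simp add: coeff_map_poly)
  with quot show "z \<in> integral_closure ?R" by (simp add: integral_closure_def)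
qed

end

lemma integral_closure_mono: "R \<subseteq> S \<Longrightarrow> integral_closure R \<subseteq> integral_closure S"
  unfolding integral_closure_def integral_over_def quotient_field_of_def by blast

theorem theorem3p4:
  fixes scale :: "'d::idom \<Rightarrow> 'a::ring_1 \<Rightarrow> 'a"
    and t :: "'a \<Rightarrow> 'd fract \<Rightarrow> 'b::ring_1"
    and n :: nat
  assumes "integrally_closed TYPE('d)"
    and "finite_residue_rings TYPE('d)"
    and "unital_algebra scale"
    and "torsion_free scale"
    and "finitely_generated scale"
    and "is_base_change_to_fract scale t"
    and "n = dim_B t"
  shows "Int_B t (A_in_B t) (A' t) = Int_K (Omega_A t) (Lambda n)
       \<and> subring (Int_B t (A_in_B t) (A' t)) ring_of_type_algebra
       \<and> to_fract ` Int_B t (A_in_B t) (A' t)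
           = integral_closure (\<Inter>a \<in> A_in_B t. pullback_ring t a)
       \<and> to_fract ` Int_B t (A_in_B t) (A' t)
           = integral_closure (Int_B t (A_in_B t) (A_in_B t))"
proof -
  interpret base_change scale t
    using assms(3,5,6) by (rule base_change.intro)
  let ?R = "\<Inter>a \<in> A_in_B t. pullback_ring t a"
    and ?I = "Int_B t (A_in_B t) (A_in_B t)" and ?I' = "Int_B t (A_in_B t) (A' t)"
  have "?I \<subseteq> ?I'" using A_subset_A' by (auto simp: Int_B_def)
  \<comment> \<open>The three inclusions form a cycle, so all three sets coincide.\<close>
  then have "to_fract ` ?I' \<subseteq> integral_closure ?R" "integral_closure ?R \<subseteq> integral_closure ?I"
    "integral_closure ?I \<subseteq> to_fract ` ?I'"
    using Int_B_subset_integral_closure[OF assms(1,2)]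
      integral_closure_mono[OF pullback_rings_subset_Int_B]
      integral_closure_subset_Int_B[OF assms(1)] by simp_all
  then have "to_fract ` ?I' = integral_closure ?R" "to_fract ` ?I' = integral_closure ?I" by blast+
  with Int_B_eq_Int_K[OF assms(1)] subring_Int_B[OF assms(1)] show ?thesis
    unfolding assms(7) by blast
qed

end
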